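(* Let $w\ge 2$ and let $\mathcal{B}=\{B_1,\ldots,B_b\}$ be an $(n,w,w-1)$ block design on the point set $[n]=\{1,\dots,n\}$. For each $i$ let $\mathbb{A}_i\subset\mathbb{R}^n$ be the subspace of vectors whose support lies in $B_i$. If the vectors $v_i\in\mathbb{A}_i$ are chosen generically, then the frame $\mathcal{F}=\{e_1,\ldots,e_n\}\cup\{v_1,\ldots,v_b\}$ in $\mathbb{R}^n$ (where $e_1,\dots,e_n$ is the standard basis) is vital. Equivalently, the POVM associated with $\mathcal{F}$ is a vital rank-one POVM of size $n+n(n-1)/w$.
   Context: An $(n,k,\lambda)$-design is a pair $(X,\mathcal{B})$ with $X=[n]=\{1,\dots,n\}$ and $\mathcal{B}=\{B_1,\dots,B_b\}$ a finite indexed collection (repetitions allowed) of subsets of $X$, called blocks, such that every block has size $k$ and every pair of distinct points is contained in exactly $\lambda$ blocks. "Generically" means: there is a nonempty Zariski open subset $U\subset\prod_{i=1}^b\mathbb{A}_i$ such that the conclusion holds for every $(v_1,\dots,v_b)\in U$. A frame in $\mathbb{R}^n$ is a finite (indexed) family of vectors spanning $\mathbb{R}^n$. A finite family $\{u_i\}_{i=1}^m\subset\mathbb{R}^n$ permits phase retrieval if for all $\psi,\phi\in\mathbb{R}^n$, $|\langle u_i,\psi\rangle|^2=|\langle u_i,\phi\rangle|^2$ for all $i$ implies $\phi=\pm\psi$. A frame is vital if it permits phase retrieval, but removing any single vector yields a family that does not permit phase retrieval. The POVM associated with a frame $\{u_i\}_{i=1}^m$ is $\{E_i=w_iw_i^T\}_{i=1}^m$,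 where $S=\sum_i u_iu_i^T$ and $w_i=S^{-1/2}u_i$. A POVM on $\mathbb{R}^n$ is a finite indexed family $\{E_i\}_{i=1}^m$ of symmetric positive semidefinite operators with $\sum_iE_i=I$; it is rank-one if each $E_i$ has rank $1$; its size is $m$. A pure state is $\operatorname{proj}(\psi)=\psi\psi^T$ with $\psi$ a unit vector. A POVM is PSI-Complete if $\rho\mapsto(\operatorname{Tr}(\rho E_i))_i$ is injective on pure states. With $S_j=\sum_{i\ne j}E_i$ and $\mathcal{D}_j=\{\rho\text{ pure}:\operatorname{Tr}(\rho S_j)>0\}$, the subcollection $\{E_i\}_{i\neq j}$ is PSI-Complete if $\rho\mapsto(\operatorname{Tr}(\rho E_i)/\operatorname{Tr}(\rho S_j))_{i\ne j}$ is injective on $\mathcal{D}_j$; by convention it is not PSI-Complete if $S_j=0$. A rank-one POVM is vital if it is PSI-Complete but for every $j$ the subcollection $\{E_i\}_{i\ne j}$ is not PSI-Complete. *)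

theory Defs
  imports "HOL-Analysis.Analysis"
begin

text \<open>A finite indexed family is an index set \<open>I\<close> together with a function on the
  index type, of which only the values on \<open>I\<close> matter; repetitions are thereby allowed.\<close>

definition block_design :: "nat \<Rightarrow> nat \<Rightarrow> nat \<Rightarrow> 'a set \<Rightarrow> nat \<Rightarrow> (nat \<Rightarrow> 'a set) \<Rightarrow> bool" where
  "block_design n k l X b B \<longleftrightarrow>
     finite X \<and> card X = n \<and>
     (\<forall>i\<in>{1..b}. B i \<subseteq> X \<and> card (B i) = k) \<and>
     (\<forall>x\<in>X. \<forall>y\<in>X. x \<noteq> y \<longrightarrow> card {i\<in>{1..b}. x \<in> B i \<and> y \<in> B i} = l)"

definition coord_subspace :: "'n::finite set \<Rightarrow> (real^'n) set" where
  "coord_subspace S = {x. {j. x $ j \<noteq> 0} \<subseteq> S}"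

text \<open>The algebra of real functions generated by the coordinates of the vectors of a family.\<close>

inductive_set poly_funs :: "'i set \<Rightarrow> (('i \<Rightarrow> real^'n::finite) \<Rightarrow> real) set" for I where
  const: "(\<lambda>_. c) \<in> poly_funs I"
| coord: "i \<in> I \<Longrightarrow> (\<lambda>v. v i $ j) \<in> poly_funs I"
| add: "p \<in> poly_funs I \<Longrightarrow> q \<in> poly_funs I \<Longrightarrow> (\<lambda>v. p v + q v) \<in> poly_funs I"
| mult: "p \<in> poly_funs I \<Longrightarrow> q \<in> poly_funs I \<Longrightarrow> (\<lambda>v. p v * q v) \<in> poly_funs I"

text \<open>Relatively open sets of \<open>X\<close>: complements in \<open>X\<close> of common zero sets of
  arbitrary sets of polynomials.\<close>

definition zariski_open_in :: "'i set \<Rightarrow> ('i \<Rightarrow> real^'n::finite) set \<Rightarrow> ('i \<Rightarrow> real^'n) set \<Rightarrow> bool" where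
  "zariski_open_in I X U \<longleftrightarrow>
     (\<exists>P \<subseteq> poly_funs I. U = X - {v. \<forall>p\<in>P. p v = 0})"

definition generically ::
    "'i set \<Rightarrow> ('i \<Rightarrow> (real^'n::finite) set) \<Rightarrow> (('i \<Rightarrow> real^'n) \<Rightarrow> bool) \<Rightarrow> bool" where
  "generically I A Q \<longleftrightarrow>
     (\<exists>U. zariski_open_in I (Pi\<^sub>E I A) U \<and> U \<noteq> {} \<and> (\<forall>v\<in>U. Q v))"

definition is_frame :: "'i set \<Rightarrow> ('i \<Rightarrow> real^'n::finite) \<Rightarrow> bool" where
  "is_frame I u \<longleftrightarrow> finite I \<and> span (u ` I) = UNIV"

definition permits_phase_retrieval :: "'i set \<Rightarrow> ('i \<Rightarrow> real^'n::finite) \<Rightarrow> bool" where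
  "permits_phase_retrieval I u \<longleftrightarrow>
     (\<forall>\<psi> \<phi>. (\<forall>i\<in>I. \<bar>u i \<bullet> \<psi>\<bar>\<^sup>2 = \<bar>u i \<bullet> \<phi>\<bar>\<^sup>2) \<longrightarrow> \<phi> = \<psi> \<or> \<phi> = - \<psi>)"

definition vital_frame :: "'i set \<Rightarrow> ('i \<Rightarrow> real^'n::finite) \<Rightarrow> bool" where
  "vital_frame I u \<longleftrightarrow>
     is_frame I u \<and> permits_phase_retrieval I u \<and>
     (\<forall>j\<in>I. \<not> permits_phase_retrieval (I - {j}) u)"

definition pos_semidef :: "real^'n^'n::finite \<Rightarrow> bool" where
  "pos_semidef A \<longleftrightarrow> transpose A = A \<and> (\<forall>x. 0 \<le> x \<bullet> (A *v x))"

text \<open>The matrix \<open>x x\<^sup>T\<close>. The type constraint is essential: \<open>columnvector x\<close> has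
  polymorphic width.\<close>

definition outer_self :: "real^'n::finite \<Rightarrow> real^'n^'n" where
  "outer_self x = (columnvector x :: real^1^'n) ** rowvector x"

definition is_povm :: "'i set \<Rightarrow> ('i \<Rightarrow> real^'n^'n::finite) \<Rightarrow> bool" where
  "is_povm I E \<longleftrightarrow> finite I \<and> (\<forall>i\<in>I. pos_semidef (E i)) \<and> (\<Sum>i\<in>I. E i) = mat 1"

definition rank_one_povm :: "'i set \<Rightarrow> ('i \<Rightarrow> real^'n^'n::finite) \<Rightarrow> bool" where
  "rank_one_povm I E \<longleftrightarrow> is_povm I E \<and> (\<forall>i\<in>I. rank (E i) = 1)"

definition pure_states :: "(real^'n^'n::finite) set" where
  "pure_states = {outer_self x | x. norm x = 1}"

definition psi_complete :: "'i set \<Rightarrow> ('i \<Rightarrow> real^'n^'n::finite) \<Rightarrow> bool" where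
  "psi_complete I E \<longleftrightarrow> inj_on (\<lambda>\<rho>. \<lambda>i\<in>I. trace (\<rho> ** E i)) pure_states"

definition sub_psi_complete :: "'i set \<Rightarrow> ('i \<Rightarrow> real^'n^'n::finite) \<Rightarrow> 'i \<Rightarrow> bool" where
  "sub_psi_complete I E j \<longleftrightarrow>
     (let S = (\<Sum>i\<in>I - {j}. E i) in
       S \<noteq> 0 \<and>
       inj_on (\<lambda>\<rho>. \<lambda>i\<in>I - {j}. trace (\<rho> ** E i) / trace (\<rho> ** S))
         {\<rho>\<in>pure_states. trace (\<rho> ** S) > 0})"

definition vital_rank_one_povm :: "'i set \<Rightarrow> ('i \<Rightarrow> real^'n^'n::finite) \<Rightarrow> bool" where
  "vital_rank_one_povm I E \<longleftrightarrow>
     rank_one_povm I E \<and> psi_complete I E \<and> (\<forall>j\<in>I. \<not> sub_psi_complete I E j)"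

text \<open>The positive semidefinite square root, meaningful for positive semidefinite
  arguments only, where it exists and is unique.\<close>

definition psd_sqrt :: "real^'n^'n::finite \<Rightarrow> real^'n^'n" where
  "psd_sqrt A = (THE R. pos_semidef R \<and> R ** R = A)"

definition frame_operator :: "'i set \<Rightarrow> ('i \<Rightarrow> real^'n::finite) \<Rightarrow> real^'n^'n" where
  "frame_operator I u = (\<Sum>i\<in>I. outer_self (u i))"

definition frame_povm :: "'i set \<Rightarrow> ('i \<Rightarrow> real^'n::finite) \<Rightarrow> 'i \<Rightarrow> real^'n^'n" where
  "frame_povm I u i = outer_self (psd_sqrt (matrix_inv (frame_operator I u)) *v u i)"

definition basis_block_index :: "nat \<Rightarrow> ('n::finite + nat) set" where
  "basis_block_index b = UNIV <+> {1..b}"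

definition basis_block_family :: "(nat \<Rightarrow> real^'n::finite) \<Rightarrow> 'n + nat \<Rightarrow> real^'n" where
  "basis_block_family v = case_sum (\<lambda>j. axis j 1) v"

end

theory Submission imports Defs begin

text \<open>By the complement property, phase retrieval fails exactly if there are nonzero \<open>x\<close>, \<open>y\<close> such that
  every frame vector is orthogonal to \<open>x\<close> or to \<open>y\<close>. The vectors \<open>e j\<close> force \<open>x\<close> and \<open>y\<close> to have
  disjoint supports \<open>S\<close> and \<open>T\<close>. For generic \<open>v\<close>, the \<open>v i\<close> orthogonal to \<open>x\<close> exclude \<open>x \<noteq> 0\<close> once
  their blocks admit a system of distinct representatives for \<open>S\<close>; similarly for \<open>y\<close> and \<open>T\<close>. If Hall's
  condition failed on both sides, at subsets of sizes \<open>a\<close> and \<open>c\<close>, then at most \<open>a + c - 2\<close> blocks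
  would meet both subsets; but as pairs are covered \<open>w - 1\<close> times by blocks of size \<open>w\<close>, there are at
  least \<open>a + c - 1\<close> of them. Conversely, every point lies in exactly \<open>n - 1\<close> blocks. Hence some \<open>e j\<close>
  is orthogonal to all but \<open>n - 1\<close> of the vectors that are left after the removal of one, and some
  \<open>y \<noteq> 0\<close> is orthogonal to those \<open>n - 1\<close>. The equivalence with POVMs holds for every frame, because
  \<open>u i\<close> is mapped to \<open>w i\<close> by a symmetric invertible matrix.\<close>

section \<open>Generic properties\<close>

lemma poly_funs_sum:
  assumes "\<And>a. a \<in> X \<Longrightarrow> f a \<in> poly_funs I"
  shows "(\<lambda>v. \<Sum>a\<in>X. f a v) \<in> poly_funs I"
  using assms
  by (induction X rule: infinite_finite_induct) (auto intro: poly_funs.intros)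

lemma poly_funs_prod:
  assumes "\<And>a. a \<in> X \<Longrightarrow> f a \<in> poly_funs I"
  shows "(\<lambda>v. \<Prod>a\<in>X. f a v) \<in> poly_funs I"
  using assms
  by (induction X rule: infinite_finite_induct) (auto intro: poly_funs.intros)

lemma poly_funs_det:
  fixes M :: "('i \<Rightarrow> real^'n::finite) \<Rightarrow> real^'m^'m::finite"
  assumes "\<And>i j. (\<lambda>v. M v $ i $ j) \<in> poly_funs I"
  shows "(\<lambda>v. det (M v)) \<in> poly_funs I"
  unfolding det_def
  by (intro poly_funs_sum poly_funs.mult poly_funs_prod poly_funs.const assms)

text \<open>Reduces polynomial functions on a product of subspaces to univariate polynomials. The
  restriction to \<open>I\<close> keeps the points of the line in the extensional product.\<close>

lemma poly_funs_on_line: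
  fixes x y :: "'i \<Rightarrow> real^'n::finite"
  assumes "p \<in> poly_funs I"
  shows "\<exists>q. \<forall>t. p (\<lambda>i\<in>I. x i + t *\<^sub>R (y i - x i)) = poly q t"
  using assms
proof induction
  case (const c)
  show ?case by (intro exI[of _ "[:c:]"]) simp
next
  case (coord i j)
  then show ?case by (intro exI[of _ "[:x i $ j, y i $ j - x i $ j:]"]) simp
next
  case (add p q)
  then show ?case by (metis poly_add)
next
  case (mult p q)
  then show ?case by (metis poly_mult)
qed

text \<open>Restricted to a line through a nonzero of \<open>p\<close> and a nonzero of \<open>q\<close>, both are nonzero
  univariate polynomials, and they have only finitely many roots.\<close>

lemma poly_funs_common_nonzero:
  fixes A :: "'i \<Rightarrow> (real^'n::finite) set"
  assumes sub: "\<And>i. i \<in> I \<Longrightarrow> subspace (A i)"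
    and p: "p \<in> poly_funs I" and x: "x \<in> Pi\<^sub>E I A" "p x \<noteq> 0"
    and q: "q \<in> poly_funs I" and y: "y \<in> Pi\<^sub>E I A" "q y \<noteq> 0"
  obtains z where "z \<in> Pi\<^sub>E I A" "p z * q z \<noteq> 0"
proof -
  define l where "l t = (\<lambda>i\<in>I. x i + t *\<^sub>R (y i - x i))" for t
  obtain P where P: "\<And>t. p (l t) = poly P t"
    using poly_funs_on_line[OF p, of x y] unfolding l_def by blast
  obtain Q where Q: "\<And>t. q (l t) = poly Q t"
    using poly_funs_on_line[OF q, of x y] unfolding l_def by blast
  have "l 0 = x" "l 1 = y"
    using x(1) y(1) by (auto simp: l_def fun_eq_iff PiE_def extensional_def)
  then have "P \<noteq> 0" "Q \<noteq> 0"
    using x(2) y(2) P[of 0] Q[of 1] by auto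
  then have "finite {t. poly (P * Q) t = 0}"
    by (intro poly_roots_finite) simp
  then obtain t where "poly (P * Q) t \<noteq> 0"
    using ex_new_if_finite[OF infinite_UNIV_char_0] by blast
  moreover have "l t \<in> Pi\<^sub>E I A"
    using x(1) y(1) sub unfolding l_def
    by (auto intro!: subspace_add subspace_mul subspace_diff)
  ultimately show thesis
    using that[of "l t"] by (simp add: P Q)
qed

text \<open>The finitely many conditions merge into one: the product over \<open>P\<close> is a
  single polynomial, whose nonvanishing set is Zariski open. By induction on \<open>P\<close> this
  set is nonempty, since two polynomials that do not vanish identically have a common
  nonzero.\<close>

lemma generically_poly_nonzero:
  fixes A :: "'i \<Rightarrow> (real^'n::finite) set"
  assumes sub: "\<And>i. i \<in> I \<Longrightarrow> subspace (A i)"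
    and "finite P" "P \<subseteq> poly_funs I"
    and "\<And>p. p \<in> P \<Longrightarrow> \<exists>v\<in>Pi\<^sub>E I A. p v \<noteq> 0"
  shows "generically I A (\<lambda>v. \<forall>p\<in>P. p v \<noteq> 0)"
proof -
  have "\<exists>v\<in>Pi\<^sub>E I A. (\<Prod>p\<in>P. p v) \<noteq> 0"
    using assms(2-4)
  proof (induction P)
    case empty
    have "(\<lambda>i\<in>I. 0) \<in> Pi\<^sub>E I A"
      using sub by (auto intro: subspace_0)
    then show ?case by (rule bexI[rotated]) simp
  next
    case (insert p P)
    obtain x where x: "x \<in> Pi\<^sub>E I A" "p x \<noteq> 0"
      using insert.prems(2)[of p] by blast
    obtain y where y: "y \<in> Pi\<^sub>E I A" "(\<Prod>p\<in>P. p y) \<noteq> 0"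
      using insert.IH insert.prems by blast
    have p: "p \<in> poly_funs I" and q: "(\<lambda>v. \<Prod>p\<in>P. p v) \<in> poly_funs I"
      using insert.prems by (auto intro: poly_funs_prod)
    obtain z where "z \<in> Pi\<^sub>E I A" "p z * (\<Prod>p\<in>P. p z) \<noteq> 0"
      using sub by (rule poly_funs_common_nonzero[OF _ p x q y])
    then show ?case
      using insert.hyps by auto
  qed
  then have "Pi\<^sub>E I A - {v. \<forall>q\<in>{\<lambda>v. \<Prod>p\<in>P. p v}. q v = 0} \<noteq> {}"
    by auto
  moreover have "zariski_open_in I (Pi\<^sub>E I A) (Pi\<^sub>E I A - {v. \<forall>q\<in>{\<lambda>v. \<Prod>p\<in>P. p v}. q v = 0})"
    using assms(3) unfolding zariski_open_in_def
    by (intro exI[of _ "{\<lambda>v. \<Prod>p\<in>P. p v}"] conjI) (auto intro!: poly_funs_prod)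
  moreover have "p v \<noteq> 0"
    if "v \<in> Pi\<^sub>E I A - {v. \<forall>q\<in>{\<lambda>v. \<Prod>p\<in>P. p v}. q v = 0}" "p \<in> P" for p v
    using that assms(2) by auto
  ultimately show ?thesis
    unfolding generically_def
    by (intro exI[of _ "Pi\<^sub>E I A - {v. \<forall>q\<in>{\<lambda>v. \<Prod>p\<in>P. p v}. q v = 0}"]) simp
qed

text \<open>A Zariski open set lies in the product, so \<open>Q\<close> may be derived from
  \<open>P\<close> together with the membership of each \<open>v i\<close> in
  \<open>A i\<close>.\<close>

lemma generically_mono:
  assumes "generically I A P" "\<And>v. v \<in> Pi\<^sub>E I A \<Longrightarrow> P v \<Longrightarrow> Q v"
  shows "generically I A Q"
proof -
  obtain U where U: "zariski_open_in I (Pi\<^sub>E I A) U" "U \<noteq> {}" "\<forall>v\<in>U. P v"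
    using assms(1) unfolding generically_def by auto
  then have "U \<subseteq> Pi\<^sub>E I A"
    unfolding zariski_open_in_def by auto
  then show ?thesis
    using U assms(2) unfolding generically_def by (intro exI[of _ U]) auto
qed

section \<open>Hall's theorem\<close>

text \<open>The Halmos-Vaughan induction on \<open>card S\<close>. If every proper nonempty subset
  has a surplus of neighbours, one element is matched arbitrarily; otherwise a tight proper subset
  \<open>K\<close> and its complement are matched separately.\<close>

lemma hall_marriage:
  fixes A :: "'a \<Rightarrow> 'b set"
  assumes "finite S" "\<And>s. s \<in> S \<Longrightarrow> finite (A s)"
    and "\<And>S'. S' \<subseteq> S \<Longrightarrow> card S' \<le> card (\<Union>(A ` S'))"
  shows "\<exists>f. inj_on f S \<and> (\<forall>s\<in>S. f s \<in> A s)"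
  using assms
proof (induction "card S" arbitrary: S A rule: less_induct)
  case less
  note fin = less.prems(1,2) and hall = less.prems(3)
  consider "S = {}" | (slack) "S \<noteq> {}" "\<And>S'. S' \<subset> S \<Longrightarrow> S' \<noteq> {} \<Longrightarrow> card S' < card (\<Union>(A ` S'))"
    | (tight) K where "K \<subset> S" "K \<noteq> {}" "card (\<Union>(A ` K)) \<le> card K"
    by (meson not_less)
  then show ?case
  proof cases
    case slack
    then obtain s where s: "s \<in> S" by blast
    have "A s \<noteq> {}"
      using hall[of "{s}"] s by auto
    then obtain y where y: "y \<in> A s" by blast
    have "\<exists>f. inj_on f (S - {s}) \<and> (\<forall>t\<in>S - {s}. f t \<in> A t - {y})"
    proof (rule less.hyps)
      show "card (S - {s}) < card S"
        using s fin(1) by (rule card_Diff1_less[rotated])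
      show "card S' \<le> card (\<Union>t\<in>S'. A t - {y})" if "S' \<subseteq> S - {s}" for S'
      proof (cases "S' = {}")
        case False
        have "(\<Union>t\<in>S'. A t - {y}) = \<Union>(A ` S') - {y}" by blast
        \<comment> \<open>The strict inequality pays for the removal of \<open>y\<close>.\<close>
        moreover have "card S' < card (\<Union>(A ` S'))"
          using that s False by (intro slack(2)) auto
        ultimately show ?thesis
          by (auto simp: card_Diff_singleton_if)
      qed simp
    qed (use fin in auto)
    then obtain f where f: "inj_on f (S - {s})" "\<And>t. t \<in> S - {s} \<Longrightarrow> f t \<in> A t - {y}"
      by blast
    moreover have "inj_on (f(s := y)) S"
      unfolding inj_on_def
    proof (intro ballI impI)
      fix t u assume "t \<in> S" "u \<in> S" "(f(s := y)) t = (f(s := y)) u"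
      then show "t = u"
        using f(2)[of t] f(2)[of u] inj_onD[OF f(1), of t u] by (auto split: if_splits)
    qed
    ultimately show ?thesis
      using y by (intro exI[of _ "f(s := y)"]) auto
  next
    case tight
    have finK: "finite K"
      using tight(1) fin(1) finite_subset by blast
    have "\<exists>f. inj_on f K \<and> (\<forall>s\<in>K. f s \<in> A s)"
      using tight(1) fin finK hall by (intro less.hyps psubset_card_mono) auto
    then obtain f where f: "inj_on f K" "\<And>s. s \<in> K \<Longrightarrow> f s \<in> A s" by blast
    have "\<exists>g. inj_on g (S - K) \<and> (\<forall>s\<in>S - K. g s \<in> A s - \<Union>(A ` K))"
    proof (rule less.hyps)
      show "card (S - K) < card S"
        using tight(1,2) fin(1) by (intro psubset_card_mono) auto
      show "card S' \<le> card (\<Union>s\<in>S'. A s - \<Union>(A ` K))" if "S' \<subseteq> S - K" for S'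
      proof -
        \<comment> \<open>Hall's condition is applied to \<open>S' \<union> K\<close>; the at most
          \<open>card K\<close> neighbours of \<open>K\<close> are then subtracted.\<close>
        have "finite S'" "S' \<inter> K = {}"
          using that fin(1) by (auto intro: finite_subset)
        then have "card S' + card K = card (S' \<union> K)"
          by (simp add: card_Un_disjoint finK)
        also have "\<dots> \<le> card (\<Union>(A ` (S' \<union> K)))"
          using that tight(1) by (intro hall) auto
        also have "\<Union>(A ` (S' \<union> K)) = (\<Union>s\<in>S'. A s - \<Union>(A ` K)) \<union> \<Union>(A ` K)"
          by blast
        also have "card \<dots> \<le> card (\<Union>s\<in>S'. A s - \<Union>(A ` K)) + card (\<Union>(A ` K))"
          by (rule card_Un_le)
        finally show ?thesis
          using tight(3) by simp
      qed
    qed (use fin in auto)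
    then obtain g where g: "inj_on g (S - K)" "\<And>s. s \<in> S - K \<Longrightarrow> g s \<in> A s - \<Union>(A ` K)"
      by blast
    let ?h = "\<lambda>s. if s \<in> K then f s else g s"
    have "?h s \<in> A s" if "s \<in> S" for s
      using f(2) g(2) that by auto
    moreover have "inj_on ?h S"
    proof (rule inj_onI)
      fix s t assume st: "s \<in> S" "t \<in> S" "?h s = ?h t"
      show "s = t"
      proof (cases "s \<in> K \<longleftrightarrow> t \<in> K")
        case True
        then show ?thesis
          using st inj_onD[OF f(1), of s t] inj_onD[OF g(1), of s t] by (auto split: if_splits)
      next
        case False
        then show ?thesis
          using st f(2)[of s] f(2)[of t] g(2)[of s] g(2)[of t] by (auto split: if_splits)
      qed
    qed
    ultimately show ?thesis by blast
  qed simp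
qed

section \<open>Counting in block designs\<close>

text \<open>Equivalently, \<open>(x + y - 1) / (x y) = 1 - (1 - 1/x) (1 - 1/y)\<close> is decreasing in \<open>x\<close> and \<open>y\<close>. Here \<open>x\<close> and
  \<open>y\<close> will be the numbers of points that a block shares with sets of sizes \<open>a\<close> and \<open>c\<close>.\<close>

lemma crossing_pair_inequality:
  fixes a c x y :: real
  assumes "1 \<le> x" "x \<le> a" "1 \<le> y" "y \<le> c"
  shows "(a + c - 1) * (x * y) \<le> (x + y - 1) * (a * c)"
proof -
  \<comment> \<open>Telescoping: first \<open>(x - 1) * a\<close> is exchanged for
    \<open>(a - 1) * x\<close>, which leaves \<open>x - a\<close>, then \<open>(y - 1) * c\<close>
    for \<open>(c - 1) * y\<close>, which leaves \<open>y - c\<close>.\<close>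
  have "(x - 1) * (y - 1) * (a * c) - (a - 1) * (c - 1) * (x * y) =
      (x - a) * (y - 1) * c + (y - c) * (a - 1) * x"
    by algebra
  moreover have "(x - a) * (y - 1) * c \<le> 0" "(y - c) * (a - 1) * x \<le> 0"
    using assms by (auto intro!: mult_nonpos_nonneg)
  ultimately have "(x - 1) * (y - 1) * (a * c) \<le> (a - 1) * (c - 1) * (x * y)"
    by linarith
  then show ?thesis by (simp add: algebra_simps)
qed

text \<open>Double counting of the incidences \<open>P i y\<close>.\<close>

lemma sum_card_eq:
  assumes "finite I" "finite Y"
  shows "(\<Sum>i\<in>I. card {y\<in>Y. P i y}) = (\<Sum>y\<in>Y. card {i\<in>I. P i y})"
  using sum.swap[of "\<lambda>i y. if P i y then 1 else (0::nat)" Y I] assms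
  by (simp add: sum.If_cases Int_def)

locale critical_design =
  fixes n w b :: nat and X :: "'a set" and B :: "nat \<Rightarrow> 'a set"
  assumes w: "w \<ge> 2" and design: "block_design n w (w - 1) X b B"
begin

lemma finite_points: "finite X"
  and card_points: "card X = n"
  and block_subset: "i \<in> {1..b} \<Longrightarrow> B i \<subseteq> X"
  and block_card: "i \<in> {1..b} \<Longrightarrow> card (B i) = w"
  and pair_count: "x \<in> X \<Longrightarrow> y \<in> X \<Longrightarrow> x \<noteq> y \<Longrightarrow> card {i\<in>{1..b}. x \<in> B i \<and> y \<in> B i} = w - 1"
  using design unfolding block_design_def by blast+

lemma finite_block: "i \<in> {1..b} \<Longrightarrow> finite (B i)"
  using block_subset finite_points finite_subset by blast

text \<open>Double counting of the pairs of a block through \<open>x\<close> and a further point on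
  it: each such block has \<open>w - 1\<close> further points, and each further point lies on
  \<open>w - 1\<close> such blocks. This common factor is positive and cancels.\<close>

lemma replication_number:
  assumes x: "x \<in> X"
  shows "card {i\<in>{1..b}. x \<in> B i} = n - 1"
proof -
  let ?R = "{i\<in>{1..b}. x \<in> B i}"
  have "(\<Sum>i\<in>?R. card {y\<in>X - {x}. y \<in> B i}) = (\<Sum>y\<in>X - {x}. card {i\<in>?R. y \<in> B i})"
    by (rule sum_card_eq) (simp_all add: finite_points)
  moreover have "card {y\<in>X - {x}. y \<in> B i} = w - 1" if "i \<in> ?R" for i
  proof -
    have "{y\<in>X - {x}. y \<in> B i} = B i - {x}"
      using that block_subset by blast
    then show ?thesis
      using that block_card by simp
  qed
  moreover have "card {i\<in>?R. y \<in> B i} = w - 1" if "y \<in> X - {x}" for y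
    using pair_count[of x y] that x by (auto simp: conj_assoc)
  ultimately have "card ?R * (w - 1) = (n - 1) * (w - 1)"
    using x by (simp add: card_points)
  then show ?thesis
    using w by simp
qed

text \<open>Double counting of the incidences between points and blocks; it determines the size of
  the frame.\<close>

lemma block_count: "b * w = n * (n - 1)"
proof -
  have "(\<Sum>i\<in>{1..b}. card {x\<in>X. x \<in> B i}) = (\<Sum>x\<in>X. card {i\<in>{1..b}. x \<in> B i})"
    by (rule sum_card_eq) (simp_all add: finite_points)
  moreover have "card {x\<in>X. x \<in> B i} = w" if "i \<in> {1..b}" for i
  proof -
    have "{x\<in>X. x \<in> B i} = B i"
      using that block_subset by blast
    then show ?thesis
      using that block_card by simp
  qed
  moreover have "(\<Sum>x\<in>X. card {i\<in>{1..b}. x \<in> B i}) = (\<Sum>x\<in>X. n - 1)"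
    by (rule sum.cong[OF refl replication_number])
  ultimately show ?thesis
    by (simp add: card_points)
qed

text \<open>The \<open>card S * card T\<close> pairs are covered \<open>w - 1\<close> times each,
  and a block that shares \<open>x\<close> points with \<open>S\<close> and \<open>y\<close> points
  with \<open>T\<close> covers \<open>x * y\<close> of them. As \<open>x + y \<le> w\<close>,
  \<open>crossing_pair_inequality\<close> shows that one block accounts for at most the fraction
  \<open>1 / (card S + card T - 1)\<close> of the total.\<close>

lemma crossing_blocks:
  assumes S: "S \<subseteq> X" "S \<noteq> {}" and T: "T \<subseteq> X" "T \<noteq> {}" and disj: "S \<inter> T = {}"
  shows "card S + card T - 1 \<le> card {i\<in>{1..b}. B i \<inter> S \<noteq> {} \<and> B i \<inter> T \<noteq> {}}"
proof -
  let ?N = "{i\<in>{1..b}. B i \<inter> S \<noteq> {} \<and> B i \<inter> T \<noteq> {}}"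
  let ?a = "real (card S)" and ?c = "real (card T)"
  let ?x = "\<lambda>i. real (card (B i \<inter> S))" and ?y = "\<lambda>i. real (card (B i \<inter> T))"
  have fin: "finite S" "finite T"
    using S(1) T(1) finite_points finite_subset by blast+
  have pos: "?a > 0" "?c > 0"
    using fin S(2) T(2) by (simp_all add: card_gt_0_iff)
  have "(\<Sum>i\<in>{1..b}. card {p\<in>S \<times> T. fst p \<in> B i \<and> snd p \<in> B i}) =
      (\<Sum>p\<in>S \<times> T. card {i\<in>{1..b}. fst p \<in> B i \<and> snd p \<in> B i})"
    by (rule sum_card_eq) (simp_all add: fin)
  moreover have "card {p\<in>S \<times> T. fst p \<in> B i \<and> snd p \<in> B i} = card (B i \<inter> S) * card (B i \<inter> T)" for i
  proof -
    have "{p\<in>S \<times> T. fst p \<in> B i \<and> snd p \<in> B i} = (B i \<inter> S) \<times> (B i \<inter> T)"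
      by auto
    then show ?thesis by (simp add: card_cartesian_product)
  qed
  moreover have "card {i\<in>{1..b}. fst p \<in> B i \<and> snd p \<in> B i} = w - 1" if "p \<in> S \<times> T" for p
    using that S T disj by (intro pair_count) auto
  ultimately have "(\<Sum>i\<in>{1..b}. card (B i \<inter> S) * card (B i \<inter> T)) = card S * card T * (w - 1)"
    by (simp add: card_cartesian_product)
  moreover have "(\<Sum>i\<in>{1..b}. card (B i \<inter> S) * card (B i \<inter> T)) =
      (\<Sum>i\<in>?N. card (B i \<inter> S) * card (B i \<inter> T))"
    by (intro sum.mono_neutral_right) auto
  ultimately have "real (\<Sum>i\<in>?N. card (B i \<inter> S) * card (B i \<inter> T)) = real (card S * card T * (w - 1))"
    by simp
  then have total: "(\<Sum>i\<in>?N. ?x i * ?y i) = ?a * ?c * real (w - 1)"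
    by (simp only: of_nat_sum of_nat_mult)
  have bound: "(?a + ?c - 1) * (?x i * ?y i) \<le> real (w - 1) * (?a * ?c)" if "i \<in> ?N" for i
  proof -
    have i: "i \<in> {1..b}" "B i \<inter> S \<noteq> {}" "B i \<inter> T \<noteq> {}"
      using that by auto
    have "card (B i \<inter> S) + card (B i \<inter> T) = card ((B i \<inter> S) \<union> (B i \<inter> T))"
      using fin disj by (intro card_Un_disjoint[symmetric]) auto
    also have "\<dots> \<le> w"
      using i(1) finite_block block_card by (metis card_mono inf_le1 le_sup_iff)
    finally have "?x i + ?y i - 1 \<le> real (w - 1)"
      using w by linarith
    moreover have "(?a + ?c - 1) * (?x i * ?y i) \<le> (?x i + ?y i - 1) * (?a * ?c)"
      using i fin by (intro crossing_pair_inequality)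
        (auto simp: card_mono card_gt_0_iff real_of_nat_ge_one_iff Suc_le_eq)
    ultimately show ?thesis
      using pos by (smt (verit) mult_right_mono mult_pos_pos)
  qed
  have "(?a + ?c - 1) * (?a * ?c * real (w - 1)) = (\<Sum>i\<in>?N. (?a + ?c - 1) * (?x i * ?y i))"
    by (simp only: total sum_distrib_left[symmetric])
  also have "\<dots> \<le> (\<Sum>i\<in>?N. real (w - 1) * (?a * ?c))"
    by (rule sum_mono) (rule bound)
  also have "\<dots> = real (card ?N) * (?a * ?c * real (w - 1))"
    by simp
  finally have "?a + ?c - 1 \<le> real (card ?N)"
    using pos w by (subst (asm) mult_le_cancel_right) auto
  then show ?thesis by linarith
qed

end

section \<open>Phase retrieval\<close>

text \<open>With \<open>x = \<psi> + \<phi>\<close> and \<open>y = \<psi> - \<phi>\<close>, the equations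
  \<open>\<bar>u i \<bullet> \<psi>\<bar> = \<bar>u i \<bullet> \<phi>\<bar>\<close> become \<open>(u i \<bullet> x) (u i \<bullet> y) = 0\<close>.\<close>

lemma permits_phase_retrieval_iff:
  "permits_phase_retrieval I u \<longleftrightarrow>
     (\<forall>x y. (\<forall>i\<in>I. u i \<bullet> x = 0 \<or> u i \<bullet> y = 0) \<longrightarrow> x = 0 \<or> y = 0)"
proof -
  have eq: "\<bar>a \<bullet> \<psi>\<bar>\<^sup>2 = \<bar>a \<bullet> \<phi>\<bar>\<^sup>2 \<longleftrightarrow> a \<bullet> (\<psi> + \<phi>) = 0 \<or> a \<bullet> (\<psi> - \<phi>) = 0" for a \<psi> \<phi> :: "real^'b"
    by (auto simp: power2_eq_iff inner_add_right inner_diff_right)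
  show ?thesis
  proof
    assume *: "permits_phase_retrieval I u"
    show "\<forall>x y. (\<forall>i\<in>I. u i \<bullet> x = 0 \<or> u i \<bullet> y = 0) \<longrightarrow> x = 0 \<or> y = 0"
    proof (intro allI impI)
      fix x y assume xy: "\<forall>i\<in>I. u i \<bullet> x = 0 \<or> u i \<bullet> y = 0"
      define \<psi> \<phi> where "\<psi> = (1/2) *\<^sub>R (x + y)" and "\<phi> = (1/2) *\<^sub>R (x - y)"
      have x: "x = \<psi> + \<phi>" and y: "y = \<psi> - \<phi>"
        by (simp_all add: \<psi>_def \<phi>_def flip: scaleR_add_right scaleR_diff_right)
      have "\<phi> = \<psi> \<or> \<phi> = - \<psi>"
        using * xy unfolding permits_phase_retrieval_def eq x y by blast
      then show "x = 0 \<or> y = 0"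
        by (auto simp: x y)
    qed
  next
    assume *: "\<forall>x y. (\<forall>i\<in>I. u i \<bullet> x = 0 \<or> u i \<bullet> y = 0) \<longrightarrow> x = 0 \<or> y = 0"
    show "permits_phase_retrieval I u"
      unfolding permits_phase_retrieval_def eq
    proof (intro allI impI)
      fix \<psi> \<phi> assume "\<forall>i\<in>I. u i \<bullet> (\<psi> + \<phi>) = 0 \<or> u i \<bullet> (\<psi> - \<phi>) = 0"
      then have "\<psi> + \<phi> = 0 \<or> \<psi> - \<phi> = 0"
        using * by blast
      then show "\<phi> = \<psi> \<or> \<phi> = - \<psi>"
        by (auto simp: add_eq_0_iff)
    qed
  qed
qed

lemma exists_orthogonal_to_few:
  fixes u :: "'i \<Rightarrow> real^'n::finite"
  assumes "finite J" "card J < CARD('n)"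
  obtains y where "y \<noteq> 0" "\<And>i. i \<in> J \<Longrightarrow> u i \<bullet> y = 0"
proof -
  have "dim (u ` J) < DIM(real^'n)"
    using assms dim_le_card'[of "u ` J"] card_image_le[of J u] by simp
  then obtain y where "y \<noteq> 0" "\<And>z. z \<in> span (u ` J) \<Longrightarrow> orthogonal y z"
    using orthogonal_to_subspace_exists by blast
  then show thesis
    using that[of y] by (metis imageI inner_commute orthogonal_def span_base)
qed

text \<open>The violating pair consists of \<open>x\<close> and a nonzero \<open>y\<close>
  orthogonal to the few vectors that are not orthogonal to \<open>x\<close>.\<close>

lemma not_phase_retrieval_if_few_nonorthogonal:
  fixes u :: "'i \<Rightarrow> real^'n::finite"
  assumes "finite I" "x \<noteq> 0" "card {i\<in>I. u i \<bullet> x \<noteq> 0} < CARD('n)"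
  shows "\<not> permits_phase_retrieval I u"
proof -
  obtain y where "y \<noteq> 0" "\<And>i. i \<in> {i\<in>I. u i \<bullet> x \<noteq> 0} \<Longrightarrow> u i \<bullet> y = 0"
    using exists_orthogonal_to_few[of "{i\<in>I. u i \<bullet> x \<noteq> 0}" u] assms by auto
  then show ?thesis
    using assms(2) unfolding permits_phase_retrieval_iff by blast
qed

lemma finite_basis_block_index: "finite (basis_block_index b :: ('n::finite + nat) set)"
  by (simp add: basis_block_index_def)

lemma is_frame_basis_block:
  "is_frame (basis_block_index b) (basis_block_family v :: 'n::finite + nat \<Rightarrow> real^'n)"
proof -
  have "(Basis :: (real^'n) set) \<subseteq> (basis_block_family v :: 'n + nat \<Rightarrow> real^'n) ` basis_block_index b"
    by (force simp: Basis_vec_def basis_block_index_def basis_block_family_def)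
  then show ?thesis
    unfolding is_frame_def using span_mono[of Basis] span_Basis finite_basis_block_index by blast
qed

lemma inner_axis_one: "axis j 1 \<bullet> (x :: real^'n::finite) = x $ j"
  by (simp add: inner_axis')

section \<open>The frame of a design\<close>

text \<open>The determinant \<open>minor_poly f S v\<close> is nonzero if and only if the vectors \<open>v (f s)\<close>
  for \<open>s \<in> S\<close>, restricted to \<open>S\<close>, form a basis of the space of vectors supported on \<open>S\<close>.\<close>

definition minor_poly :: "('n::finite \<Rightarrow> 'i) \<Rightarrow> 'n set \<Rightarrow> ('i \<Rightarrow> real^'n) \<Rightarrow> real" where
  "minor_poly f S v = det (\<chi> s. if s \<in> S then v (f s) else axis s 1)"

lemma minor_poly_in_poly_funs:
  assumes "f ` S \<subseteq> I"
  shows "minor_poly f S \<in> poly_funs I"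
  unfolding minor_poly_def
proof (rule poly_funs_det)
  show "(\<lambda>v. (\<chi> s. if s \<in> S then v (f s) else axis s 1) $ i $ j) \<in> poly_funs I" for i j
    using assms by (cases "i \<in> S") (auto intro: poly_funs.intros)
qed

text \<open>The rows in \<open>S\<close> annihilate \<open>x\<close> by the last hypothesis, the
  unit rows outside \<open>S\<close> by the bound on the support. Thus an invertible matrix sends
  \<open>x\<close> to 0.\<close>

lemma zero_if_minor_poly_nonzero:
  assumes "minor_poly f S v \<noteq> 0" "{j. x $ j \<noteq> 0} \<subseteq> S" "\<And>s. s \<in> S \<Longrightarrow> v (f s) \<bullet> x = 0"
  shows "x = 0"
proof -
  let ?M = "\<chi> s. if s \<in> S then v (f s) else axis s 1"
  have "?M *v x = 0"
    using assms(2,3) by (auto simp: vec_eq_iff matrix_vector_mul_component inner_axis_one)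
  moreover have "invertible ?M"
    using assms(1) by (simp add: invertible_det_nz minor_poly_def)
  ultimately show ?thesis
    using inj_matrix_vector_mult[of ?M] by (auto dest: injD[of _ x 0])
qed

lemma subspace_coord_subspace: "subspace (coord_subspace S)"
  by (auto simp: subspace_def coord_subspace_def subset_iff) (metis add.right_neutral)

text \<open>With \<open>axis s 1\<close> at the index \<open>f s\<close> and 0 at all other indices,
  the matrix of \<open>minor_poly\<close> is the identity; the supports are as required because
  \<open>s\<close> lies in \<open>B (f s)\<close>.\<close>

lemma minor_poly_nonzero_somewhere:
  fixes B :: "'i \<Rightarrow> 'n::finite set"
  assumes "inj_on f S" "f ` S \<subseteq> I" "\<And>s. s \<in> S \<Longrightarrow> s \<in> B (f s)"
  obtains v where "v \<in> (\<Pi>\<^sub>E i\<in>I. coord_subspace (B i))" "minor_poly f S v \<noteq> 0"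
proof
  let ?v = "\<lambda>i\<in>I. if i \<in> f ` S then axis (the_inv_into S f i) 1 else (0 :: real^'n)"
  have v: "?v (f s) = axis s 1" if "s \<in> S" for s
    using that assms(1,2) by (auto simp: the_inv_into_f_f)
  show "?v \<in> (\<Pi>\<^sub>E i\<in>I. coord_subspace (B i))"
  proof (rule restrict_PiE_iff[THEN iffD2], intro ballI)
    fix i assume "i \<in> I"
    show "(if i \<in> f ` S then axis (the_inv_into S f i) 1 else 0) \<in> coord_subspace (B i)"
      using assms(1,3) by (auto simp: coord_subspace_def the_inv_into_f_f axis_def)
  qed
  have "(\<chi> s. if s \<in> S then ?v (f s) else axis s 1) = (mat 1 :: real^'n^'n)"
    using v by (simp add: vec_eq_iff mat_def axis_def)
  then show "minor_poly f S ?v \<noteq> 0"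
    by (simp add: minor_poly_def)
qed

section \<open>Distinct representatives in a critical design\<close>

context critical_design
begin

text \<open>Meant for the supports \<open>S\<close>, \<open>T\<close> of two vectors
  \<open>x\<close>, \<open>y\<close> and the sets \<open>J\<close>, \<open>K\<close> of blocks whose
  vectors are orthogonal to \<open>x\<close>, \<open>y\<close>. If Hall's condition fails twice, the
  violating sets \<open>S'\<close> and \<open>T'\<close> have too few neighbours in \<open>J\<close>
  and \<open>K\<close> to account for all blocks that meet both.\<close>

lemma sdr_for_one_side:
  assumes S: "S \<subseteq> X" and T: "T \<subseteq> X" and "S \<inter> T = {}"
    and cover: "J \<union> K = {1..b}"
  shows "(\<exists>f. inj_on f S \<and> (\<forall>s\<in>S. f s \<in> J \<and> s \<in> B (f s))) \<or>
         (\<exists>f. inj_on f T \<and> (\<forall>t\<in>T. f t \<in> K \<and> t \<in> B (f t)))"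
proof (rule ccontr)
  assume contr: "\<not> ?thesis"
  have finJK: "finite J" "finite K"
    using cover by (metis finite_Un finite_atLeastAtMost)+
  have finST: "finite S" "finite T"
    using S T finite_points finite_subset by blast+
  have "\<exists>S'\<subseteq>S. card (\<Union>s\<in>S'. {i\<in>J. s \<in> B i}) < card S'"
  proof (rule ccontr)
    assume "\<not> ?thesis"
    then have "\<exists>f. inj_on f S \<and> (\<forall>s\<in>S. f s \<in> {i\<in>J. s \<in> B i})"
      using finJK finST by (intro hall_marriage) (auto simp: not_less)
    then show False
      using contr by simp
  qed
  then obtain S' where S': "S' \<subseteq> S" "card (\<Union>s\<in>S'. {i\<in>J. s \<in> B i}) < card S'" by blast
  have "\<exists>T'\<subseteq>T. card (\<Union>t\<in>T'. {i\<in>K. t \<in> B i}) < card T'"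
  proof (rule ccontr)
    assume "\<not> ?thesis"
    then have "\<exists>f. inj_on f T \<and> (\<forall>t\<in>T. f t \<in> {i\<in>K. t \<in> B i})"
      using finJK finST by (intro hall_marriage) (auto simp: not_less)
    then show False
      using contr by simp
  qed
  then obtain T' where T': "T' \<subseteq> T" "card (\<Union>t\<in>T'. {i\<in>K. t \<in> B i}) < card T'" by blast
  let ?N = "{i\<in>{1..b}. B i \<inter> S' \<noteq> {} \<and> B i \<inter> T' \<noteq> {}}"
  have "S' \<noteq> {}" "T' \<noteq> {}"
    using S'(2) T'(2) by auto
  then have "card S' + card T' - 1 \<le> card ?N"
    using S' T' assms by (intro crossing_blocks) auto
  \<comment> \<open>A block that meets both sets lies in \<open>J\<close> and is counted as a
    neighbour of \<open>S'\<close>, or lies in \<open>K\<close> and is counted as a neighbour of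
    \<open>T'\<close>.\<close>
  also have "card ?N \<le> card ((\<Union>s\<in>S'. {i\<in>J. s \<in> B i}) \<union> (\<Union>t\<in>T'. {i\<in>K. t \<in> B i}))"
    using finJK S'(1) T'(1) finST cover by (intro card_mono) (auto intro: finite_subset)
  also have "\<dots> \<le> card (\<Union>s\<in>S'. {i\<in>J. s \<in> B i}) + card (\<Union>t\<in>T'. {i\<in>K. t \<in> B i})"
    by (rule card_Un_le)
  finally show False
    using S'(2) T'(2) by linarith
qed

end

text \<open>Since \<open>x\<close> and \<open>y\<close> are arbitrary, the minors for all sets
  \<open>S\<close> and all systems \<open>f\<close> of distinct representatives are required to be
  nonzero at once. They are finitely many because \<open>f\<close> ranges over extensional
  functions.\<close>

lemma generically_phase_retrieval:
  fixes B :: "nat \<Rightarrow> 'n::finite set"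
  assumes "critical_design n w b (UNIV :: 'n set) B"
  shows "generically {1..b} (\<lambda>i. coord_subspace (B i))
    (\<lambda>v. permits_phase_retrieval (basis_block_index b) (basis_block_family v))"
proof -
  interpret critical_design n w b "UNIV :: 'n set" B by fact
  let ?F = "\<lambda>S. {f \<in> S \<rightarrow>\<^sub>E {1..b}. inj_on f S \<and> (\<forall>s\<in>S. s \<in> B (f s))}"
  define P where "P = (\<Union>S. (\<lambda>f. minor_poly f S) ` ?F S)"
  have "finite P"
    unfolding P_def
    by (intro finite_UN_I finite_imageI finite_subset[OF Collect_restrict] finite_PiE) simp_all
  moreover have "P \<subseteq> poly_funs {1..b}"
    unfolding P_def by (auto intro!: minor_poly_in_poly_funs)
  moreover have "\<exists>v\<in>\<Pi>\<^sub>E i\<in>{1..b}. coord_subspace (B i). p v \<noteq> 0" if p: "p \<in> P" for p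
  proof -
    obtain S where "p \<in> (\<lambda>f. minor_poly f S) ` ?F S"
      using p unfolding P_def by (rule UN_E)
    then obtain f where p_eq: "p = minor_poly f S" and "f \<in> ?F S"
      by (rule imageE)
    then have "inj_on f S" "f ` S \<subseteq> {1..b}" "\<And>s. s \<in> S \<Longrightarrow> s \<in> B (f s)"
      by auto
    then obtain v where "v \<in> (\<Pi>\<^sub>E i\<in>{1..b}. coord_subspace (B i))" "minor_poly f S v \<noteq> 0"
      by (rule minor_poly_nonzero_somewhere)
    then show ?thesis
      unfolding p_eq by (intro bexI[of _ v])
  qed
  ultimately have "generically {1..b} (\<lambda>i. coord_subspace (B i)) (\<lambda>v. \<forall>p\<in>P. p v \<noteq> 0)"
    by (intro generically_poly_nonzero subspace_coord_subspace)
  then show ?thesis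
  proof (rule generically_mono)
    fix v assume nz: "\<forall>p\<in>P. p v \<noteq> 0"
    \<comment> \<open>Distinct representatives for the support of \<open>z\<close>, taken among the
      blocks whose vectors are orthogonal to \<open>z\<close>, force \<open>z = 0\<close>.\<close>
    have zero: "z = 0"
      if "inj_on f {j. z $ j \<noteq> 0}"
        and "\<forall>s\<in>{j. z $ j \<noteq> 0}. f s \<in> {i\<in>{1..b}. v i \<bullet> z = 0} \<and> s \<in> B (f s)" for f z
    proof (rule zero_if_minor_poly_nonzero[OF _ subset_refl])
      let ?S = "{j. z $ j \<noteq> 0}"
      have "restrict f ?S \<in> ?F ?S"
        using that by (auto simp: inj_on_def)
      then show "minor_poly (restrict f ?S) ?S v \<noteq> 0"
        using nz unfolding P_def by blast
      show "v (restrict f ?S s) \<bullet> z = 0" if "s \<in> ?S" for s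
        using that \<open>\<forall>s\<in>?S. f s \<in> {i\<in>{1..b}. v i \<bullet> z = 0} \<and> s \<in> B (f s)\<close> by simp
    qed
    show "permits_phase_retrieval (basis_block_index b) (basis_block_family v)"
      unfolding permits_phase_retrieval_iff
    proof (intro allI impI)
      fix x y
      assume *: "\<forall>i\<in>basis_block_index b. basis_block_family v i \<bullet> x = 0 \<or> basis_block_family v i \<bullet> y = 0"
      \<comment> \<open>Since \<open>axis j 1\<close> belongs to the family, coordinate
        \<open>j\<close> vanishes in \<open>x\<close> or in \<open>y\<close>.\<close>
      have coords: "{j. x $ j \<noteq> 0} \<inter> {j. y $ j \<noteq> 0} = {}"
        using *
        by (force simp: basis_block_index_def basis_block_family_def inner_axis_one)
      have "v i \<bullet> x = 0 \<or> v i \<bullet> y = 0" if i: "i \<in> {1..b}" for i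
        using *[rule_format, of "Inr i"] InrI[OF i, of UNIV]
        by (simp add: basis_block_index_def basis_block_family_def)
      then have cover: "{i\<in>{1..b}. v i \<bullet> x = 0} \<union> {i\<in>{1..b}. v i \<bullet> y = 0} = {1..b}"
        by blast
      have "(\<exists>f. inj_on f {j. x $ j \<noteq> 0} \<and>
            (\<forall>s\<in>{j. x $ j \<noteq> 0}. f s \<in> {i\<in>{1..b}. v i \<bullet> x = 0} \<and> s \<in> B (f s))) \<or>
          (\<exists>f. inj_on f {j. y $ j \<noteq> 0} \<and>
            (\<forall>s\<in>{j. y $ j \<noteq> 0}. f s \<in> {i\<in>{1..b}. v i \<bullet> y = 0} \<and> s \<in> B (f s)))"
        by (rule sdr_for_one_side[OF subset_UNIV subset_UNIV coords cover])
      then show "x = 0 \<or> y = 0"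
        by (elim disjE exE conjE)
          (rule disjI1, rule zero, assumption+, rule disjI2, rule zero, assumption+)
    qed
  qed
qed

text \<open>Apart from itself, \<open>axis j 1\<close> can be nonorthogonal only to the
  \<open>n - 1\<close> vectors whose blocks contain \<open>j\<close>. If \<open>j\<close> is chosen
  such that \<open>k\<close> indexes one of these \<open>n\<close> vectors, fewer than
  \<open>n\<close> of them remain after the removal.\<close>

lemma not_phase_retrieval_after_removal:
  fixes B :: "nat \<Rightarrow> 'n::finite set"
  assumes "critical_design n w b (UNIV :: 'n set) B"
    and v: "v \<in> (\<Pi>\<^sub>E i\<in>{1..b}. coord_subspace (B i))"
    and k: "k \<in> basis_block_index b"
  shows "\<not> permits_phase_retrieval (basis_block_index b - {k}) (basis_block_family v)"
proof -
  interpret critical_design n w b "UNIV :: 'n set" B by fact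
  let ?N = "\<lambda>j. insert (Inl j) (Inr ` {i\<in>{1..b}. j \<in> B i})"
  \<comment> \<open>For a basis vector, \<open>j\<close> is its own index; for a block vector,
    \<open>j\<close> is any point of its block.\<close>
  have "\<exists>j. k \<in> ?N j"
  proof (cases k)
    case (Inr i)
    then have i: "i \<in> {1..b}"
      using k by (auto simp: basis_block_index_def)
    then have "B i \<noteq> {}"
      using block_card[OF i] w by auto
    then show ?thesis
      using i Inr by auto
  qed auto
  then obtain j where j: "k \<in> ?N j" by blast
  \<comment> \<open>One index for \<open>axis j 1\<close> and \<open>n - 1\<close> for the blocks
    through \<open>j\<close>; the sum is \<open>n\<close> because the point set is nonempty.\<close>
  have "card (?N j) = CARD('n)"
    using replication_number[of j] card_points zero_less_card_finite[where 'a = 'n]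
    by (simp add: card_image image_iff)
  then have less: "card (?N j - {k}) < CARD('n)"
    using card_Diff1_less[OF _ j] by simp
  have sub: "{i\<in>basis_block_index b - {k}. basis_block_family v i \<bullet> axis j 1 \<noteq> 0} \<subseteq> ?N j - {k}"
  proof
    fix l assume l: "l \<in> {i\<in>basis_block_index b - {k}. basis_block_family v i \<bullet> axis j 1 \<noteq> 0}"
    show "l \<in> ?N j - {k}"
    proof (cases l)
      case (Inl i)
      then show ?thesis
        using l by (cases "i = j") (auto simp: basis_block_family_def inner_axis_axis)
    next
      case (Inr i)
      then have "i \<in> {1..b}" "v i $ j \<noteq> 0"
        using l by (auto simp: basis_block_index_def basis_block_family_def inner_axis)
      moreover from this have "j \<in> B i"
        using v by (auto simp: PiE_iff coord_subspace_def)
      ultimately show ?thesis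
        using Inr l by auto
    qed
  qed
  have "card {i\<in>basis_block_index b - {k}. basis_block_family v i \<bullet> axis j 1 \<noteq> 0} < CARD('n)"
    using card_mono[OF _ sub] less by simp
  then show ?thesis
    by (intro not_phase_retrieval_if_few_nonorthogonal[of _ "axis j 1"])
      (simp_all add: finite_basis_block_index axis_eq_0_iff)
qed

section \<open>Spectral theorem and square roots\<close>

text \<open>The eigenvector is a maximiser \<open>x\<close> of \<open>x \<bullet> f x\<close> on the unit sphere of \<open>W\<close>: with \<open>M\<close> the maximum,
  the form of \<open>g = M - f\<close> is nonnegative on \<open>W\<close> and zero at \<open>x\<close>, which forces \<open>g x = 0\<close>.\<close>

lemma selfadjoint_eigenvector:
  fixes f :: "'a::euclidean_space \<Rightarrow> 'a"
  assumes lin: "linear f" and adj: "\<And>x y. f x \<bullet> y = x \<bullet> f y"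
    and W: "subspace W" "f ` W \<subseteq> W" "W \<noteq> {0}"
  obtains x c where "x \<in> W" "norm x = 1" "f x = c *\<^sub>R x"
proof -
  let ?S = "sphere 0 1 \<inter> W"
  obtain y where y: "y \<in> W" "y \<noteq> 0"
    using W(1,3) subspace_0 by blast
  then have "y /\<^sub>R norm y \<in> ?S"
    using W(1) by (simp add: subspace_mul)
  moreover have "compact ?S"
    using W(1) by (intro compact_Int_closed closed_subspace) simp_all
  moreover have "continuous_on ?S (\<lambda>x. x \<bullet> f x)"
    using lin by (intro continuous_intros linear_continuous_on) (simp add: linear_conv_bounded_linear)
  ultimately obtain x where x: "x \<in> ?S" "\<And>y. y \<in> ?S \<Longrightarrow> y \<bullet> f y \<le> x \<bullet> f x"
    using continuous_attains_sup[of ?S "\<lambda>x. x \<bullet> f x"] by blast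
  define M where "M = x \<bullet> f x"
  define g where "g y = M *\<^sub>R y - f y" for y
  have nonneg: "0 \<le> y \<bullet> g y" if "y \<in> W" for y
  proof (cases "y = 0")
    case False
    then have "y /\<^sub>R norm y \<in> ?S"
      using that W(1) by (simp add: subspace_mul)
    then have "(y /\<^sub>R norm y) \<bullet> f (y /\<^sub>R norm y) \<le> M"
      unfolding M_def by (rule x(2))
    then show ?thesis
      using False by (simp add: g_def linear_cmul[OF lin] inner_diff_right field_simps
          power2_norm_eq_inner[symmetric] power2_eq_square)
  qed (simp add: g_def)
  define z where "z = g x"
  have xx: "x \<bullet> x = 1"
    using x(1) by (simp add: norm_eq_1)
  have z: "z \<in> W"
    unfolding z_def g_def using W(1,2) x(1) by (auto intro!: subspace_diff subspace_mul)
  \<comment> \<open>The nonnegative form of \<open>g\<close> is expanded at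
    \<open>x + t *\<^sub>R z\<close>. Its constant term \<open>x \<bullet> z\<close> vanishes by the
    definition of \<open>M\<close>.\<close>
  have "0 \<le> 2 * t * (z \<bullet> z) + t\<^sup>2 * (z \<bullet> g z)" for t
  proof -
    have "g (x + t *\<^sub>R z) = z + t *\<^sub>R g z"
      unfolding z_def g_def
      by (simp only: linear_add[OF lin] linear_cmul[OF lin]) (simp add: algebra_simps)
    moreover have "x \<bullet> z = 0"
      using xx by (simp add: z_def g_def M_def inner_diff_right)
    moreover have "x \<bullet> g z = z \<bullet> z"
      unfolding z_def g_def 
      by (simp add: linear_diff[OF lin] linear_cmul[OF lin] inner_diff_right inner_diff_left
          flip: adj)
    ultimately have "(x + t *\<^sub>R z) \<bullet> g (x + t *\<^sub>R z) = 2 * t * (z \<bullet> z) + t\<^sup>2 * (z \<bullet> g z)"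
      by (simp add: inner_add_left inner_add_right power2_eq_square algebra_simps)
    moreover have "0 \<le> (x + t *\<^sub>R z) \<bullet> g (x + t *\<^sub>R z)"
      using W(1) x(1) z by (intro nonneg) (auto intro!: subspace_add subspace_mul)
    ultimately show ?thesis by simp
  qed
  note quad = this
  have "z \<bullet> z = 0"
  proof (rule ccontr)
    assume "z \<bullet> z \<noteq> 0"
    then have pos: "z \<bullet> z > 0"
      by (simp add: order_less_le)
    define q where "q = z \<bullet> g z"
    have "0 \<le> q"
      unfolding q_def by (rule nonneg[OF z])
    \<comment> \<open>This \<open>t\<close> turns the quadratic into
      \<open>- t\<^sup>2 * (q + 2)\<close>; the summand 1 keeps the denominator positive even if
      \<open>q = 0\<close>.\<close>
    define t where "t = - (z \<bullet> z) / (q + 1)"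
    have "2 * t * (z \<bullet> z) + t\<^sup>2 * q < 0"
    proof -
      have t: "t * (q + 1) = - (z \<bullet> z)"
        using \<open>0 \<le> q\<close> by (simp add: t_def)
      have "2 * t * (z \<bullet> z) + t\<^sup>2 * q = - t\<^sup>2 * (q + 2)"
        using t by algebra
      moreover have "t \<noteq> 0"
        using t pos by auto
      ultimately show ?thesis
        using \<open>0 \<le> q\<close> by (simp add: mult_neg_pos)
    qed
    then show False
      using quad[of t] by (simp add: q_def)
  qed
  then have "f x = M *\<^sub>R x"
    by (simp add: z_def g_def)
  then show thesis
    using x(1) that by auto
qed

text \<open>An eigenvector \<open>x\<close> is split off: its orthogonal complement in
  \<open>W\<close> is again invariant, because \<open>f\<close> is self-adjoint, and has smaller
  dimension. Allowing any invariant subspace \<open>W\<close> makes this induction possible.\<close>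

lemma selfadjoint_eigenbasis:
  fixes f :: "'a::euclidean_space \<Rightarrow> 'a"
  assumes lin: "linear f" and adj: "\<And>x y. f x \<bullet> y = x \<bullet> f y"
    and "subspace W" "f ` W \<subseteq> W"
  shows "\<exists>E. pairwise orthogonal E \<and> span E = W \<and> (\<forall>e\<in>E. norm e = 1 \<and> (\<exists>c. f e = c *\<^sub>R e))"
  using assms(3,4)
proof (induction "dim W" arbitrary: W rule: less_induct)
  case less
  note W = less.prems
  show ?case
  proof (cases "W = {0}")
    case True
    then show ?thesis
      by (intro exI[of _ "{}"]) simp
  next
    case False
    then obtain x c where x: "x \<in> W" "norm x = 1" "f x = c *\<^sub>R x"
      using selfadjoint_eigenvector[OF lin adj W] by blast
    have xx: "x \<bullet> x = 1"
      using x(2) by (simp add: norm_eq_1)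
    let ?V = "{y \<in> W. x \<bullet> y = 0}"
    have V: "subspace ?V"
      using W(1) by (auto simp: subspace_def inner_add_right)
    have "f ` ?V \<subseteq> ?V"
      using W(2) by (auto simp: adj[symmetric] x(3))
    moreover have "dim ?V < dim W"
    proof (rule dim_psubset)
      have "?V \<subset> W"
      proof
        have "x \<notin> ?V"
          using xx by simp
        then show "?V \<noteq> W"
          using x(1) by metis
      qed blast
      then show "span ?V \<subset> span W"
        using V W(1) by (simp add: span_eq_iff[THEN iffD2])
    qed
    ultimately obtain E where E: "pairwise orthogonal E" "span E = ?V"
        "\<And>e. e \<in> E \<Longrightarrow> norm e = 1 \<and> (\<exists>c. f e = c *\<^sub>R e)"
      using less.hyps[OF _ V] by blast
    have EV: "E \<subseteq> ?V"
      using E(2) span_superset by blast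
    have "pairwise orthogonal (insert x E)"
      using E(1) EV by (auto simp: pairwise_insert orthogonal_def inner_commute)
    moreover have "span (insert x E) = W"
    proof
      show "span (insert x E) \<subseteq> W"
        using x(1) EV W(1) by (intro span_minimal) auto
      show "W \<subseteq> span (insert x E)"
      proof
        fix y assume "y \<in> W"
        then have "y - (x \<bullet> y) *\<^sub>R x \<in> span E"
          using x(1) xx W(1) unfolding E(2)
          by (auto simp: inner_diff_right intro!: subspace_diff subspace_mul)
        then show "y \<in> span (insert x E)"
          unfolding span_insert by blast
      qed
    qed
    ultimately show ?thesis
      using E(3) x(2,3) by (intro exI[of _ "insert x E"]) auto
  qed
qed

section \<open>Positive semidefinite matrices\<close>

lemma pos_semidef_inner: "pos_semidef A \<Longrightarrow> (A *v x) \<bullet> y = x \<bullet> (A *v y)"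
  unfolding pos_semidef_def by (metis dot_lmul_matrix vector_transpose_matrix)

lemma outer_self_nth: "outer_self x $ i $ j = x $ i * x $ j"
  by (simp add: outer_self_def matrix_matrix_mult_def columnvector_def rowvector_def)

lemma outer_self_mult: "outer_self x *v y = (x \<bullet> y) *\<^sub>R x"
  by (simp add: vec_eq_iff matrix_vector_mult_def outer_self_nth inner_vec_def sum_distrib_left
      mult_ac)

lemma pos_semidef_outer_self: "pos_semidef (outer_self x)"
  unfolding pos_semidef_def
  by (auto simp: vec_eq_iff transpose_def outer_self_nth outer_self_mult inner_commute)

lemma pos_semidef_scaleR: "0 \<le> c \<Longrightarrow> pos_semidef A \<Longrightarrow> pos_semidef (c *\<^sub>R A)"
  by (simp add: pos_semidef_def transpose_scalar scaleR_matrix_vector_assoc[symmetric])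

lemma sum_matrix_vector_mult:
  fixes M :: "'i \<Rightarrow> real^'n^'m"
  shows "(\<Sum>i\<in>I. M i) *v x = (\<Sum>i\<in>I. M i *v x)"
  by (induction I rule: infinite_finite_induct) (simp_all add: matrix_vector_mult_add_rdistrib)

lemma transpose_add: "transpose (A + B) = transpose A + transpose B"
  by (simp add: transpose_def vec_eq_iff)

lemma pos_semidef_sum: "(\<And>i. i \<in> I \<Longrightarrow> pos_semidef (M i)) \<Longrightarrow> pos_semidef (\<Sum>i\<in>I. M i)"
proof (induction I rule: infinite_finite_induct)
  case (insert i I)
  then show ?case
    by (simp add: pos_semidef_def transpose_add matrix_vector_mult_add_rdistrib inner_add_right)
qed (simp_all add: pos_semidef_def transpose_def vec_eq_iff)

text \<open>This yields the uniqueness of the square root. As \<open>R\<^sup>2 - c\<^sup>2\<close>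
  factors into \<open>R + c\<close> and \<open>R - c\<close>, the vector
  \<open>z = (R - c) e\<close> satisfies \<open>R z = - c z\<close>, and nonnegativity of
  \<open>R\<close> leaves only \<open>c = 0\<close> or \<open>z = 0\<close>. In the first case
  \<open>z = R e\<close>, so \<open>z \<bullet> z = e \<bullet> R z = 0\<close>.\<close>

lemma pos_semidef_root_eigenvector:
  assumes R: "pos_semidef R" and "0 \<le> c" and e: "R *v (R *v e) = c\<^sup>2 *\<^sub>R e"
  shows "R *v e = c *\<^sub>R e"
proof -
  define z where "z = R *v e - c *\<^sub>R e"
  have Rz: "R *v z = - c *\<^sub>R z"
    by (simp add: z_def matrix_vector_mult_diff_distrib matrix_vector_mult_scaleR e algebra_simps
        power2_eq_square)
  have "0 \<le> z \<bullet> (R *v z)"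
    using R by (simp add: pos_semidef_def)
  then have "c * (z \<bullet> z) \<le> 0"
    by (simp add: Rz)
  then have "c = 0 \<or> z = 0"
    using \<open>0 \<le> c\<close> inner_ge_zero[of z] by (auto simp: mult_le_0_iff)
  moreover have "z = 0" if "c = 0"
  proof -
    have "z \<bullet> z = e \<bullet> (R *v z)"
      using that pos_semidef_inner[OF R] by (simp add: z_def)
    then show ?thesis
      using that Rz by simp
  qed
  ultimately show ?thesis
    by (auto simp: z_def)
qed

text \<open>On an orthonormal eigenbasis \<open>E\<close> of \<open>A\<close>, the root
  \<open>R\<close> scales each vector by the square root of its eigenvalue. Every other positive
  semidefinite root agrees with \<open>R\<close> on \<open>E\<close> by
  \<open>pos_semidef_root_eigenvector\<close>.\<close>

lemma psd_sqrt_ex1: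
  assumes A: "pos_semidef A"
  shows "\<exists>!R. pos_semidef R \<and> R ** R = A"
proof -
  obtain E where E: "pairwise orthogonal E" "span E = UNIV"
      "\<And>e. e \<in> E \<Longrightarrow> norm e = 1" "\<And>e. e \<in> E \<Longrightarrow> \<exists>c. A *v e = c *\<^sub>R e"
    using selfadjoint_eigenbasis[OF matrix_vector_mul_linear pos_semidef_inner[OF A] subspace_UNIV]
    by auto
  have ortho: "e \<bullet> e' = (if e = e' then 1 else 0)" if "e \<in> E" "e' \<in> E" for e e'
    using that E(1,3) by (auto simp: pairwise_def orthogonal_def norm_eq_1)
  have fin: "finite E"
    using E(1) pairwise_orthogonal_imp_finite by blast
  \<comment> \<open>For a unit eigenvector \<open>e\<close>, the value
    \<open>e \<bullet> (A *v e)\<close> is its eigenvalue.\<close>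
  define c where "c e = sqrt (e \<bullet> (A *v e))" for e
  have c: "0 \<le> c e" "A *v e = (c e)\<^sup>2 *\<^sub>R e" if "e \<in> E" for e
  proof -
    have "0 \<le> e \<bullet> (A *v e)"
      using A by (simp add: pos_semidef_def)
    then show "0 \<le> c e" "A *v e = (c e)\<^sup>2 *\<^sub>R e"
      using E(4)[OF that] ortho[OF that that] by (auto simp: c_def)
  qed
  define R where "R = (\<Sum>e\<in>E. c e *\<^sub>R outer_self e)"
  have eq_on_E: "M = M'" if "\<And>e. e \<in> E \<Longrightarrow> M *v e = M' *v e" for M M' :: "real^'a^'a"
    unfolding matrix_eq
    using linear_eq_on_span[of "(*v) M" "(*v) M'" E] that E(2) by auto
  have R: "R *v e = c e *\<^sub>R e" if "e \<in> E" for e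
  proof -
    have "R *v e = (\<Sum>e'\<in>E. c e' *\<^sub>R (e' \<bullet> e) *\<^sub>R e')"
      unfolding R_def sum_matrix_vector_mult
      by (simp add: scaleR_matrix_vector_assoc[symmetric] outer_self_mult)
    also have "\<dots> = (\<Sum>e'\<in>E. if e' = e then c e *\<^sub>R e else 0)"
      using that by (intro sum.cong) (auto simp: ortho)
    finally show ?thesis
      using that fin by simp
  qed
  show ?thesis
  proof
    show "pos_semidef R \<and> R ** R = A"
    proof
      show "pos_semidef R"
        unfolding R_def using c(1)
        by (intro pos_semidef_sum pos_semidef_scaleR pos_semidef_outer_self)
      show "R ** R = A"
        by (rule eq_on_E)
          (simp add: matrix_vector_mul_assoc[symmetric] R c(2) matrix_vector_mult_scaleR power2_eq_square)
    qed
    show "R' = R" if R': "pos_semidef R' \<and> R' ** R' = A" for R'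
    proof (rule eq_on_E)
      fix e assume e: "e \<in> E"
      have "R' *v e = c e *\<^sub>R e"
        using R' c[OF e] by (intro pos_semidef_root_eigenvector) (auto simp: matrix_vector_mul_assoc)
      then show "R' *v e = R *v e"
        using R[OF e] by simp
    qed
  qed
qed

lemma psd_sqrt: "pos_semidef A \<Longrightarrow> pos_semidef (psd_sqrt A) \<and> psd_sqrt A ** psd_sqrt A = A"
  unfolding psd_sqrt_def by (rule theI') (rule psd_sqrt_ex1)

section \<open>Frames and rank-one POVMs\<close>

text \<open>Equality of the quadratic forms says that the linear forms of \<open>a = x + y\<close>
  and \<open>b = x - y\<close> have product zero. Evaluation at \<open>b\<close> and at
  \<open>a + b\<close> shows that one of them is zero.\<close>

lemma outer_self_eq_iff: "outer_self x = outer_self y \<longleftrightarrow> y = x \<or> y = - x"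
proof
  assume eq: "outer_self x = outer_self y"
  have *: "((x + y) \<bullet> z) * ((x - y) \<bullet> z) = 0" for z
  proof -
    have "(x \<bullet> z) *\<^sub>R x = (y \<bullet> z) *\<^sub>R y"
      using eq by (metis outer_self_mult)
    then have "((x \<bullet> z) *\<^sub>R x) \<bullet> z = ((y \<bullet> z) *\<^sub>R y) \<bullet> z"
      by simp
    then show ?thesis
      by (simp add: inner_add_left inner_diff_left algebra_simps)
  qed
  define a b where "a = x + y" and "b = x - y"
  have "a = 0 \<or> b = 0"
  proof (rule disjCI)
    assume "b \<noteq> 0"
    then have "a \<bullet> b = 0"
      using *[of b] by (simp add: a_def b_def)
    then have "(a \<bullet> a) * (b \<bullet> b) = 0"
      using *[of "a + b"] unfolding a_def[symmetric] b_def[symmetric]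
      by (simp add: inner_add_right inner_commute)
    then show "a = 0"
      using \<open>b \<noteq> 0\<close> by simp
  qed
  then show "y = x \<or> y = - x"
    by (auto simp: a_def b_def add_eq_0_iff)
qed (auto simp: vec_eq_iff outer_self_nth)

lemma trace_outer_self_mult: "trace (outer_self x ** A) = x \<bullet> (A *v x)"
proof -
  have "trace (outer_self x ** A) = trace (A ** outer_self x)"
    by (rule trace_mul_sym)
  also have "\<dots> = x \<bullet> (A *v x)"
    by (simp add: trace_def matrix_matrix_mult_def outer_self_nth inner_vec_def
        matrix_vector_mult_def sum_distrib_left mult_ac)
  finally show ?thesis .
qed

text \<open>The outcome probabilities of a rank-one POVM in a pure state are the intensities of
  phase retrieval.\<close>

lemma trace_outer_self_outer_self: "trace (outer_self x ** outer_self y) = (y \<bullet> x)\<^sup>2"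
  by (simp add: trace_outer_self_mult outer_self_mult inner_commute power2_eq_square)

lemma trace_outer_self_sum:
  "trace (outer_self x ** (\<Sum>i\<in>I. outer_self (w i))) = (\<Sum>i\<in>I. (w i \<bullet> x)\<^sup>2)"
  by (simp add: trace_outer_self_mult sum_matrix_vector_mult outer_self_mult inner_sum_right
      inner_commute power2_eq_square)

lemma rank_outer_self:
  assumes "x \<noteq> 0"
  shows "rank (outer_self x) = 1"
proof -
  have "rank (outer_self x) \<le> rank (columnvector x :: real^1^'a)"
    unfolding outer_self_def by (rule rank_mul_le_left)
  also have "\<dots> \<le> 1"
    using rank_bound[of "columnvector x :: real^1^'a"] by simp
  finally have "rank (outer_self x) \<le> 1" .
  moreover have "outer_self x \<noteq> 0"
    using assms by (auto simp: vec_eq_iff outer_self_nth)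
  ultimately show ?thesis
    using rank_eq_0[of "outer_self x"] by linarith
qed

text \<open>The hypothesis \<open>sum1\<close> is Parseval's identity. Equal intensities therefore
  force equal norms, and a pair of nonzero vectors can be scaled to unit vectors by a common
  factor.\<close>

lemma psi_complete_iff:
  assumes sum1: "(\<Sum>i\<in>I. outer_self (w i)) = mat 1"
  shows "psi_complete I (\<lambda>i. outer_self (w i)) \<longleftrightarrow> permits_phase_retrieval I w"
proof
  assume inj: "psi_complete I (\<lambda>i. outer_self (w i))"
  show "permits_phase_retrieval I w"
    unfolding permits_phase_retrieval_def
  proof (intro allI impI)
    fix \<psi> \<phi> assume "\<forall>i\<in>I. \<bar>w i \<bullet> \<psi>\<bar>\<^sup>2 = \<bar>w i \<bullet> \<phi>\<bar>\<^sup>2"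
    then have eq: "(w i \<bullet> \<psi>)\<^sup>2 = (w i \<bullet> \<phi>)\<^sup>2" if "i \<in> I" for i
      using that by simp
    have "(norm x)\<^sup>2 = (\<Sum>i\<in>I. (w i \<bullet> x)\<^sup>2)" for x
      using trace_outer_self_sum[where x = x and w = w and I = I] unfolding sum1 trace_outer_self_mult
      by (simp add: power2_norm_eq_inner)
    then have "(norm \<psi>)\<^sup>2 = (norm \<phi>)\<^sup>2"
      using eq by simp
    then have norm: "norm \<phi> = norm \<psi>"
      by simp
    show "\<phi> = \<psi> \<or> \<phi> = - \<psi>"
    proof (cases "\<psi> = 0")
      case False
      let ?n = "\<lambda>x. x /\<^sub>R norm \<psi>"
      have "(\<lambda>i\<in>I. trace (outer_self (?n \<psi>) ** outer_self (w i))) =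
          (\<lambda>i\<in>I. trace (outer_self (?n \<phi>) ** outer_self (w i)))"
        using eq by (intro restrict_ext) (simp add: trace_outer_self_outer_self power_mult_distrib)
      moreover have "outer_self (?n \<psi>) \<in> pure_states" "outer_self (?n \<phi>) \<in> pure_states"
        unfolding pure_states_def using False norm by (auto intro!: exI[of _ "?n _"])
      ultimately have "outer_self (?n \<psi>) = outer_self (?n \<phi>)"
        using inj unfolding psi_complete_def by (rule inj_onD[rotated])
      then show ?thesis
        using False by (auto simp: outer_self_eq_iff simp flip: scaleR_minus_right)
    qed (use norm in simp)
  qed
next
  assume pr: "permits_phase_retrieval I w"
  show "psi_complete I (\<lambda>i. outer_self (w i))"
    unfolding psi_complete_def
  proof (rule inj_onI)
    fix \<rho> \<sigma> :: "real^'a^'a"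
    assume "\<rho> \<in> pure_states" "\<sigma> \<in> pure_states"
    then obtain \<psi> \<phi> where \<rho>: "\<rho> = outer_self \<psi>" and \<sigma>: "\<sigma> = outer_self \<phi>"
      unfolding pure_states_def by blast
    assume "(\<lambda>i\<in>I. trace (\<rho> ** outer_self (w i))) = (\<lambda>i\<in>I. trace (\<sigma> ** outer_self (w i)))"
    then have "\<forall>i\<in>I. \<bar>w i \<bullet> \<psi>\<bar>\<^sup>2 = \<bar>w i \<bullet> \<phi>\<bar>\<^sup>2"
      by (metis (no_types, lifting) \<rho> \<sigma> power2_abs restrict_apply' trace_outer_self_outer_self)
    then show "\<rho> = \<sigma>"
      using pr unfolding permits_phase_retrieval_def \<rho> \<sigma> outer_self_eq_iff by blast
  qed
qed

lemma sub_psi_complete_outer_self_iff: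
  fixes w :: "'i \<Rightarrow> real^'n::finite"
  defines "N \<equiv> \<lambda>I x. \<Sum>i\<in>I. (w i \<bullet> x)\<^sup>2"
  shows "sub_psi_complete I (\<lambda>i. outer_self (w i)) j \<longleftrightarrow>
    (\<Sum>i\<in>I - {j}. outer_self (w i)) \<noteq> 0 \<and>
    (\<forall>\<psi> \<phi>. norm \<psi> = 1 \<longrightarrow> norm \<phi> = 1 \<longrightarrow> N (I - {j}) \<psi> > 0 \<longrightarrow> N (I - {j}) \<phi> > 0 \<longrightarrow>
      (\<forall>i\<in>I - {j}. (w i \<bullet> \<psi>)\<^sup>2 / N (I - {j}) \<psi> = (w i \<bullet> \<phi>)\<^sup>2 / N (I - {j}) \<phi>) \<longrightarrow> \<phi> = \<psi> \<or> \<phi> = - \<psi>)"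
proof -
  have "inj_on (\<lambda>\<rho>. \<lambda>i\<in>J. trace (\<rho> ** outer_self (w i)) / trace (\<rho> ** (\<Sum>i\<in>J. outer_self (w i))))
      {\<rho>\<in>pure_states. trace (\<rho> ** (\<Sum>i\<in>J. outer_self (w i))) > 0} \<longleftrightarrow>
    (\<forall>\<psi> \<phi>. norm \<psi> = 1 \<longrightarrow> norm \<phi> = 1 \<longrightarrow> N J \<psi> > 0 \<longrightarrow> N J \<phi> > 0 \<longrightarrow>
      (\<forall>i\<in>J. (w i \<bullet> \<psi>)\<^sup>2 / N J \<psi> = (w i \<bullet> \<phi>)\<^sup>2 / N J \<phi>) \<longrightarrow> \<phi> = \<psi> \<or> \<phi> = - \<psi>)"
    (is "inj_on ?f ?D \<longleftrightarrow> ?R") for J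
  proof -
    have D: "?D = outer_self ` {x. norm x = 1 \<and> N J x > 0}"
      by (auto simp: pure_states_def N_def trace_outer_self_sum)
    have tr: "trace (outer_self x ** (\<Sum>i\<in>J. outer_self (w i))) = N J x" for x
      by (simp add: N_def trace_outer_self_sum)
    have g: "(\<lambda>i\<in>J. g i) = (\<lambda>i\<in>J. h i) \<longleftrightarrow> (\<forall>i\<in>J. g i = h i)" for g h :: "'i \<Rightarrow> real"
      by (metis restrict_apply' restrict_ext)
    show ?thesis
      unfolding inj_on_def D ball_simps g tr trace_outer_self_outer_self outer_self_eq_iff by blast
  qed
  then show ?thesis
    unfolding sub_psi_complete_def Let_def by simp
qed

text \<open>After a removal, Parseval's identity is lost, and equal intensities no longer force
  equal norms directly. Completeness first gives vectors that are parallel; the common value of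
  \<open>N\<close> then fixes the factor up to sign. Vectors with \<open>N x = 0\<close> lie outside
  the domain of the states and are treated by \<open>ker\<close>.\<close>

lemma sub_psi_complete_iff:
  fixes w :: "'i \<Rightarrow> real^'n::finite"
  assumes "finite I"
  shows "sub_psi_complete I (\<lambda>i. outer_self (w i)) j \<longleftrightarrow> permits_phase_retrieval (I - {j}) w"
proof -
  define J where "J = I - {j}"
  define N where "N x = (\<Sum>i\<in>J. (w i \<bullet> x)\<^sup>2)" for x
  have finJ: "finite J"
    using assms by (simp add: J_def)
  have N_nonneg: "0 \<le> N x" for x
    unfolding N_def by (intro sum_nonneg) simp
  have N_eq_0: "N x = 0 \<longleftrightarrow> (\<forall>i\<in>J. w i \<bullet> x = 0)" for x
    unfolding N_def using finJ by (simp add: sum_nonneg_eq_0_iff)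
  have N_scaleR: "N (c *\<^sub>R x) = c\<^sup>2 * N x" for c x
    by (simp add: N_def power_mult_distrib sum_distrib_left)
  have sub: "sub_psi_complete I (\<lambda>i. outer_self (w i)) j \<longleftrightarrow>
    (\<Sum>i\<in>J. outer_self (w i)) \<noteq> 0 \<and>
    (\<forall>\<psi> \<phi>. norm \<psi> = 1 \<longrightarrow> norm \<phi> = 1 \<longrightarrow> N \<psi> > 0 \<longrightarrow> N \<phi> > 0 \<longrightarrow>
      (\<forall>i\<in>J. (w i \<bullet> \<psi>)\<^sup>2 / N \<psi> = (w i \<bullet> \<phi>)\<^sup>2 / N \<phi>) \<longrightarrow> \<phi> = \<psi> \<or> \<phi> = - \<psi>)"
    unfolding sub_psi_complete_outer_self_iff J_def N_def by (rule refl)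
  show ?thesis
    unfolding J_def[symmetric]
  proof
    assume complete: "sub_psi_complete I (\<lambda>i. outer_self (w i)) j"
    have parallel: "\<exists>c. \<phi> = c *\<^sub>R \<psi>"
      if eq: "\<And>i. i \<in> J \<Longrightarrow> (w i \<bullet> \<psi>)\<^sup>2 = (w i \<bullet> \<phi>)\<^sup>2" and pos: "N \<psi> > 0" for \<psi> \<phi>
    proof -
      have N: "N \<phi> = N \<psi>"
        using eq by (simp add: N_def)
      then have nz: "\<psi> \<noteq> 0" "\<phi> \<noteq> 0"
        using pos by (auto simp: N_def)
      have "(w i \<bullet> (\<psi> /\<^sub>R norm \<psi>))\<^sup>2 / N (\<psi> /\<^sub>R norm \<psi>) = (w i \<bullet> (\<phi> /\<^sub>R norm \<phi>))\<^sup>2 / N (\<phi> /\<^sub>R norm \<phi>)"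
        if "i \<in> J" for i
        using eq[OF that] nz by (simp add: N_scaleR N power_mult_distrib)
      moreover have "N (\<psi> /\<^sub>R norm \<psi>) > 0" "N (\<phi> /\<^sub>R norm \<phi>) > 0"
        using pos nz by (simp_all add: N_scaleR N)
      ultimately have "\<phi> /\<^sub>R norm \<phi> = \<psi> /\<^sub>R norm \<psi> \<or> \<phi> /\<^sub>R norm \<phi> = - (\<psi> /\<^sub>R norm \<psi>)"
        using complete nz unfolding sub by simp
      then have "\<phi> = (norm \<phi> / norm \<psi>) *\<^sub>R \<psi> \<or> \<phi> = - (norm \<phi> / norm \<psi>) *\<^sub>R \<psi>"
        using nz by (auto simp: field_simps dest: arg_cong[where f = "\<lambda>x. norm \<phi> *\<^sub>R x"])
      then show ?thesis by blast
    qed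
    have "(\<Sum>i\<in>J. outer_self (w i)) \<noteq> 0"
      using complete unfolding sub by blast
    then obtain k where k: "k \<in> J" "w k \<noteq> 0"
      by (metis (no_types, lifting) outer_self_nth sum.neutral vec_eq_iff zero_index mult_zero_left)
    \<comment> \<open>Adding \<open>z\<close> to \<open>w k\<close> changes no intensity, so
      \<open>w k + z\<close> is a multiple of \<open>w k\<close>; pairing with \<open>w k\<close>
      shows that the factor is 1.\<close>
    have ker: "z = 0" if z: "\<And>i. i \<in> J \<Longrightarrow> w i \<bullet> z = 0" for z
    proof -
      have "N (w k) > 0"
        using N_nonneg[of "w k"] N_eq_0[of "w k"] k by (auto simp: order_less_le)
      then obtain c where c: "w k + z = c *\<^sub>R w k"
        using parallel[of "w k" "w k + z"] z by (auto simp: inner_add_right)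
      then have "w k \<bullet> (w k + z) = c * (w k \<bullet> w k)"
        by simp
      then have "c = 1"
        using z[OF k(1)] k(2) by (simp add: inner_add_right)
      then show ?thesis
        using c by simp
    qed
    show "permits_phase_retrieval J w"
      unfolding permits_phase_retrieval_def
    proof (intro allI impI)
      fix \<psi> \<phi> assume "\<forall>i\<in>J. \<bar>w i \<bullet> \<psi>\<bar>\<^sup>2 = \<bar>w i \<bullet> \<phi>\<bar>\<^sup>2"
      then have eq: "(w i \<bullet> \<psi>)\<^sup>2 = (w i \<bullet> \<phi>)\<^sup>2" if "i \<in> J" for i
        using that by simp
      show "\<phi> = \<psi> \<or> \<phi> = - \<psi>"
      proof (cases "N \<psi> = 0")
        case True
        then have "w i \<bullet> \<psi> = 0" "w i \<bullet> \<phi> = 0" if "i \<in> J" for i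
          using that eq[OF that] by (auto simp: N_eq_0)
        then have "\<psi> = 0" "\<phi> = 0"
          by (auto intro: ker)
        then show ?thesis by simp
      next
        case False
        then have pos: "N \<psi> > 0"
          using N_nonneg[of \<psi>] by simp
        then obtain c where c: "\<phi> = c *\<^sub>R \<psi>"
          using parallel[OF eq] by blast
        have "N \<phi> = N \<psi>"
          using eq by (simp add: N_def)
        then have "c\<^sup>2 = 1"
          using pos by (simp add: c N_scaleR)
        then show ?thesis
          by (auto simp: c power2_eq_1_iff)
      qed
    qed
  next
    assume pr: "permits_phase_retrieval J w"
    show "sub_psi_complete I (\<lambda>i. outer_self (w i)) j"
      unfolding sub
    proof (intro conjI allI impI)
      show "(\<Sum>i\<in>J. outer_self (w i)) \<noteq> 0"
      proof
        assume "(\<Sum>i\<in>J. outer_self (w i)) = 0"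
        then have "N x = 0" for x
          using trace_outer_self_sum[where x = x and w = w and I = J] unfolding trace_outer_self_mult
          by (simp add: N_def)
        then have "w i \<bullet> x = 0" if "i \<in> J" for i x
          using that N_eq_0 by blast
        \<comment> \<open>All intensities vanish, so any nonzero vector contradicts phase retrieval;
          \<open>undefined\<close> is just some coordinate.\<close>
        then have "axis undefined 1 = (0 :: real^'n)"
          using pr unfolding permits_phase_retrieval_iff by blast
        then show False
          by (simp add: axis_eq_0_iff)
      qed
    next
      fix \<psi> \<phi> :: "real^'n"
      assume unit: "norm \<psi> = 1" "norm \<phi> = 1" and pos: "N \<psi> > 0" "N \<phi> > 0"
        and eq: "\<forall>i\<in>J. (w i \<bullet> \<psi>)\<^sup>2 / N \<psi> = (w i \<bullet> \<phi>)\<^sup>2 / N \<phi>"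
      \<comment> \<open>Scaling by the roots of \<open>N\<close> turns equal ratios into equal
        intensities. The resulting equality up to sign gives \<open>N \<phi> = N \<psi>\<close>, as
        both vectors are unit vectors.\<close>
      have "\<forall>i\<in>J. \<bar>w i \<bullet> (\<psi> /\<^sub>R sqrt (N \<psi>))\<bar>\<^sup>2 = \<bar>w i \<bullet> (\<phi> /\<^sub>R sqrt (N \<phi>))\<bar>\<^sup>2"
        using eq pos by (simp add: power_mult_distrib power_inverse divide_inverse mult.commute)
      then have *: "\<phi> /\<^sub>R sqrt (N \<phi>) = \<psi> /\<^sub>R sqrt (N \<psi>) \<or> \<phi> /\<^sub>R sqrt (N \<phi>) = - (\<psi> /\<^sub>R sqrt (N \<psi>))"
        using pr unfolding permits_phase_retrieval_def by blast
      then have "norm (\<phi> /\<^sub>R sqrt (N \<phi>)) = norm (\<psi> /\<^sub>R sqrt (N \<psi>))"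
        by (metis norm_minus_cancel)
      then have "N \<phi> = N \<psi>"
        using unit pos by simp
      then show "\<phi> = \<psi> \<or> \<phi> = - \<psi>"
        using * pos by (auto simp flip: scaleR_minus_right)
    qed
  qed
qed

section \<open>The POVM of a frame\<close>

lemma permits_phase_retrieval_transform:
  fixes R :: "real^'n^'n::finite"
  assumes sym: "transpose R = R" and inv: "R ** Q = mat 1"
  shows "permits_phase_retrieval I (\<lambda>i. R *v u i) \<longleftrightarrow> permits_phase_retrieval I u"
proof -
  have adj: "(R *v a) \<bullet> x = a \<bullet> (R *v x)" for a x
    using sym by (metis dot_lmul_matrix vector_transpose_matrix)
  have RQ: "R *v (Q *v x) = x" for x
    by (simp add: matrix_vector_mul_assoc inv)
  have QR: "Q *v (R *v x) = x" for x
    using inv by (simp add: matrix_vector_mul_assoc matrix_left_right_inverse[of R Q])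
  have R0: "R *v x = 0 \<longleftrightarrow> x = 0" for x
    using QR[of x] by auto
  have "(\<forall>x y. P (R *v x) (R *v y)) \<longleftrightarrow> (\<forall>x y. P x y)" for P
    using RQ by metis
  from this[of "\<lambda>x y. (\<forall>i\<in>I. u i \<bullet> x = 0 \<or> u i \<bullet> y = 0) \<longrightarrow> x = 0 \<or> y = 0"]
  show ?thesis
    unfolding permits_phase_retrieval_iff by (simp add: adj R0)
qed

text \<open>The frame operator \<open>S\<close> is invertible, since
  \<open>x \<bullet> (S *v x)\<close> is the sum of the squared inner products of \<open>x\<close>
  with a spanning family. Here \<open>R\<close> is the inverse square root of \<open>S\<close>,
  \<open>Q\<close> is \<open>R ** S\<close>, and the sum is \<open>R ** S ** R\<close>, the
  identity.\<close>

lemma frame_povm_eq_outer_self: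
  fixes u :: "'i \<Rightarrow> real^'n::finite"
  assumes frame: "is_frame I u"
  obtains R Q where "frame_povm I u = (\<lambda>i. outer_self (R *v u i))"
    "transpose R = R" "R ** Q = mat 1" "(\<Sum>i\<in>I. outer_self (R *v u i)) = mat 1"
proof -
  define S where "S = frame_operator I u"
  have S_mult: "S *v x = (\<Sum>i\<in>I. (u i \<bullet> x) *\<^sub>R u i)" for x
    by (simp add: S_def frame_operator_def sum_matrix_vector_mult outer_self_mult)
  have S_psd: "pos_semidef S"
    unfolding S_def frame_operator_def by (intro pos_semidef_sum pos_semidef_outer_self)
  have "x = 0" if "S *v x = 0" for x
  proof -
    have "(\<Sum>i\<in>I. (u i \<bullet> x)\<^sup>2) = x \<bullet> (S *v x)"
      by (simp add: S_mult inner_sum_right inner_commute power2_eq_square)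
    then have perp: "u i \<bullet> x = 0" if "i \<in> I" for i
      using that \<open>S *v x = 0\<close> frame by (simp add: is_frame_def sum_nonneg_eq_0_iff)
    have "orthogonal x y" if "y \<in> span (u ` I)" for y
      by (rule orthogonal_to_span[OF that]) (use perp in \<open>auto simp: orthogonal_def inner_commute\<close>)
    then have "orthogonal x x"
      using frame by (simp add: is_frame_def)
    then show ?thesis
      by (simp add: orthogonal_self)
  qed
  then have "invertible S"
    by (simp add: invertible_left_inverse matrix_left_invertible_ker)
  define T where "T = matrix_inv S"
  have ST: "S ** T = mat 1" and TS: "T ** S = mat 1"
    using someI_ex[OF \<open>invertible S\<close>[unfolded invertible_def]]
    unfolding T_def matrix_inv_def by blast+
  have ST_mult: "S *v (T *v x) = x" for x
    by (simp add: matrix_vector_mul_assoc ST)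
  have "pos_semidef T"
    unfolding pos_semidef_def
  proof
    have "transpose T ** S = mat 1"
      using arg_cong[OF ST, of transpose] S_psd by (simp add: matrix_transpose_mul pos_semidef_def)
    then show "transpose T = T"
      by (metis ST matrix_mul_assoc matrix_mul_lid matrix_mul_rid)
    \<comment> \<open>This is the form of \<open>S\<close> at \<open>T *v x\<close>.\<close>
    show "\<forall>x. 0 \<le> x \<bullet> (T *v x)"
      using S_psd ST_mult unfolding pos_semidef_def by (metis inner_commute)
  qed
  define R where "R = psd_sqrt T"
  have R: "pos_semidef R" "R ** R = T"
    unfolding R_def using psd_sqrt[OF \<open>pos_semidef T\<close>] by auto
  then have RRS: "R ** (R ** S) = mat 1"
    by (simp add: matrix_mul_assoc TS)
  then have RSR: "(R ** S) ** R = mat 1"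
    by (simp add: matrix_left_right_inverse)
  have "(\<Sum>i\<in>I. outer_self (R *v u i)) = mat 1"
    unfolding matrix_eq
  proof
    fix x
    have "(\<Sum>i\<in>I. outer_self (R *v u i)) *v x = R *v (S *v (R *v x))"
      by (simp add: sum_matrix_vector_mult outer_self_mult pos_semidef_inner[OF R(1)] S_mult
          linear_sum[OF matrix_vector_mul_linear] matrix_vector_mult_scaleR)
    then show "(\<Sum>i\<in>I. outer_self (R *v u i)) *v x = mat 1 *v x"
      using RSR by (simp add: matrix_vector_mul_assoc matrix_mul_assoc)
  qed
  moreover have "frame_povm I u = (\<lambda>i. outer_self (R *v u i))"
    by (simp add: fun_eq_iff frame_povm_def R_def T_def S_def)
  ultimately show thesis
    using that R(1) RRS unfolding pos_semidef_def by blast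
qed

text \<open>Both completeness conditions carry over through the symmetric invertible
  \<open>R\<close>. Rank one requires nonzero frame vectors, and vitality provides them: removing a
  zero vector would not affect phase retrieval.\<close>

theorem vital_frame_iff_vital_povm:
  assumes frame: "is_frame I u"
  shows "vital_frame I u \<longleftrightarrow> vital_rank_one_povm I (frame_povm I u)"
proof -
  obtain R Q where RQ: "frame_povm I u = (\<lambda>i. outer_self (R *v u i))"
    "transpose R = R" "R ** Q = mat 1" "(\<Sum>i\<in>I. outer_self (R *v u i)) = mat 1"
    using frame_povm_eq_outer_self[OF frame] by blast
  have fin: "finite I"
    using frame by (simp add: is_frame_def)
  have complete: "psi_complete I (frame_povm I u) \<longleftrightarrow> permits_phase_retrieval I u"
    unfolding RQ(1) psi_complete_iff[OF RQ(4)] by (rule permits_phase_retrieval_transform[OF RQ(2,3)])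
  have sub: "sub_psi_complete I (frame_povm I u) j \<longleftrightarrow> permits_phase_retrieval (I - {j}) u" for j
    unfolding RQ(1) sub_psi_complete_iff[OF fin]
    by (rule permits_phase_retrieval_transform[OF RQ(2,3)])
  have "rank_one_povm I (frame_povm I u)" if vital: "vital_frame I u"
    unfolding rank_one_povm_def is_povm_def
  proof (intro conjI ballI)
    fix i assume i: "i \<in> I"
    have "u i \<noteq> 0"
    proof
      assume "u i = 0"
      then have "permits_phase_retrieval (I - {i}) u \<longleftrightarrow> permits_phase_retrieval I u"
        using i unfolding permits_phase_retrieval_def by (metis Diff_iff inner_zero_left singletonD)
      then show False
        using vital i by (auto simp: vital_frame_def)
    qed
    moreover have "Q ** R = mat 1"
      using RQ(3) by (simp add: matrix_left_right_inverse)
    ultimately have "R *v u i \<noteq> 0"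
      by (metis matrix_vector_mul_assoc matrix_vector_mul_lid matrix_vector_mult_0_right)
    then show "rank (frame_povm I u i) = 1"
      by (simp add: RQ(1) rank_outer_self)
  qed (use fin RQ(4) in \<open>simp_all add: RQ(1) pos_semidef_outer_self\<close>)
  then show ?thesis
    using frame unfolding vital_rank_one_povm_def complete sub by (auto simp: vital_frame_def)
qed

theorem theorem4p6:
  fixes n w b :: nat
    and B :: "nat \<Rightarrow> 'n::finite set"
  assumes "w \<ge> 2"
    and "block_design n w (w - 1) (UNIV :: 'n set) b B"
  shows
    "generically {1..b} (\<lambda>i. coord_subspace (B i))
       (\<lambda>v. vital_frame (basis_block_index b) (basis_block_family v)) \<and>
     generically {1..b} (\<lambda>i. coord_subspace (B i))
       (\<lambda>v. vital_rank_one_povm (basis_block_index b)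
              (frame_povm (basis_block_index b) (basis_block_family v))) \<and>
     real (card (basis_block_index b :: ('n + nat) set)) =
       real n + real n * (real n - 1) / real w \<and>
     (\<forall>v \<in> (\<Pi>\<^sub>E i\<in>{1..b}. coord_subspace (B i)).
        vital_frame (basis_block_index b) (basis_block_family v) \<longleftrightarrow>
        vital_rank_one_povm (basis_block_index b)
          (frame_povm (basis_block_index b) (basis_block_family v)))"
proof -
  interpret critical_design n w b "UNIV :: 'n set" B
    using assms by unfold_locales
  have iff: "vital_frame (basis_block_index b) (basis_block_family v) \<longleftrightarrow>
      vital_rank_one_povm (basis_block_index b) (frame_povm (basis_block_index b) (basis_block_family v))"
    for v :: "nat \<Rightarrow> real^'n"
    by (rule vital_frame_iff_vital_povm[OF is_frame_basis_block])
  have vital: "generically {1..b} (\<lambda>i. coord_subspace (B i))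
       (\<lambda>v. vital_frame (basis_block_index b) (basis_block_family v))"
    using generically_phase_retrieval[OF critical_design_axioms]
  proof (rule generically_mono)
    fix v
    assume "v \<in> (\<Pi>\<^sub>E i\<in>{1..b}. coord_subspace (B i))"
      "permits_phase_retrieval (basis_block_index b) (basis_block_family v)"
    then show "vital_frame (basis_block_index b) (basis_block_family v)"
      using is_frame_basis_block not_phase_retrieval_after_removal[OF critical_design_axioms]
      unfolding vital_frame_def by blast
  qed
  have "real (card (basis_block_index b :: ('n + nat) set)) = real n + real n * (real n - 1) / real w"
  proof -
    \<comment> \<open>Makes the natural number \<open>n - 1\<close> agree with the real
      difference.\<close>
    have "n \<ge> 1"
      using card_points zero_less_card_finite[where 'a = 'n] by simp
    then have "real b * real w = real n * (real n - 1)"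
      using arg_cong[OF block_count, of real] by (simp add: of_nat_diff)
    then have "real b = real n * (real n - 1) / real w"
      using w by (simp add: field_simps)
    then show ?thesis
      using card_points by (simp add: basis_block_index_def card_Plus)
  qed
  then show ?thesis
    using vital iff by simp
qed

end
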